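(* Let $\mathbf{k}$ be an algebraically closed field of characteristic zero. The irreducible components of the variety $\mathfrak{T}_2$ of $2$-dimensional terminal algebras over $\mathbf{k}$ are exactly the following four sets, where each set is the union of the $GL(\mathbb V)$-orbits of the algebras listed: - $\overline{O(\mathfrak{T}_{07}( * ))}$, consisting of $\mathfrak{T}_{07}(\alpha)$ for all $\alpha\in\mathbf{k}\setminus\{1\}$, $\mathfrak{T}_{03}$, $\mathfrak{T}_{01}$, $\mathfrak{T}_{04}$, $\mathfrak{T}_{10}(1)$, $\mathbf{k}^2$; - $\overline{O(\mathfrak{T}_{09})}$, consisting of $\mathfrak{T}_{09}$, $\mathfrak{T}_{07}(0)$, $\mathfrak{T}_{08}(1)$, $\mathfrak{T}_{03}$, $\mathbf{k}^2$; - $\overline{O(\mathfrak{T}_{08}( * ))}$, consisting of $\mathfrak{T}_{08}(\alpha)$ for all $\alpha\in\mathbf{k}\setminus\{2,\frac32\}$, $\mathfrak{T}_{03}$, $\mathfrak{T}_{02}$, $\mathfrak{T}_{05}$, $\mathfrak{T}_{10}(2)$, $\mathfrak{T}_{07}(\frac32)$, $\mathbf{k}^2$; - $\overline{O(\mathfrak{T}_{10}( * ))}$, consisting of $\mathfrak{T}_{10}(\alpha)$ for all $\alpha\in\mathbf{k}$, $\mathfrak{T}_{06}$, $\mathbf{k}^2$.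
   Context: Let $\mathbb V=\mathbf{k}^2$ as a vector space. $\mathcal{A}_2=\mathrm{Hom}(\mathbb V\otimes\mathbb V,\mathbb V)\cong\mathbf{k}^8$ carries the Zariski topology; $GL(\mathbb V)$ acts by $(g*\mu)(x\otimes y)=g\mu(g^{-1}x\otimes g^{-1}y)$. For an algebra $X$, $O(X)$ is the orbit of any multiplication representing $X$; for a family $X( * )$, $O(X( * ))$ is the union of the orbits of its members; bars denote Zariski closure. $\mathfrak{T}_2\subset\mathcal{A}_2$ is the Zariski closed set of all terminal multiplications, where $\mathcal{P}$ is terminal if $[[[\mathcal{P},a],\mathcal{P}],\mathcal{P}]=0$ for every $a\in\mathbb V$, with: $[\mathcal A,a](x)=\mathcal{A}(a,x)$ for $\mathcal{A}$ bilinear and $a\in\mathbb V$; $[\mathcal{A},\mathcal{B}](x,y)=\mathcal{A}(\mathcal{B}(x,y))-\mathcal{B}(\mathcal{A}(x),y)-\mathcal{B}(x,\mathcal{A}(y))$ for $\mathcal{A}$ linear and $\mathcal{B}$ bilinear; and for $\mathcal{A},\mathcal{B}$ bilinear $$[\mathcal A,\mathcal B](x,y,z)=\mathcal A(\mathcal B(x,y),z)+\mathcal A(x,\mathcal B(y,z))+\mathcal A(y,\mathcal B(x,z))-\mathcal B(\mathcal A(x,y),z)-\mathcal B(x,\mathcal A(y,z))-\mathcal B(y,\mathcal A(x,z)).$$ Notation for algebras (basis $e_1,e_2$; unlisted products are zero); $\mathbf{k}^2$ denotes the algebra with zero multiplication. $\mathfrak{T}_{01}$: $e_1e_1=e_1+e_2$,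 $e_1e_2=e_2$. $\mathfrak{T}_{02}$: $e_1e_1=e_1+e_2$, $e_1e_2=2e_2$, $e_2e_1=-e_2$. $\mathfrak{T}_{03}$: $e_1e_1=e_2$. $\mathfrak{T}_{04}$: $e_2e_1=e_1$. $\mathfrak{T}_{05}$: $e_1e_2=2e_1$, $e_2e_1=-e_1$. $\mathfrak{T}_{06}$: $e_1e_2=e_2$, $e_2e_1=-e_2$. $\mathfrak{T}_{07}(\alpha)$, $\alpha\in\mathbf{k}\setminus\{1\}$: $e_1e_1=e_1$, $e_1e_2=\alpha e_2$. $\mathfrak{T}_{08}(\alpha)$, $\alpha\in\mathbf{k}\setminus\{2,\frac32\}$: $e_1e_1=e_1$, $e_1e_2=\alpha e_2$, $e_2e_1=(3-2\alpha)e_2$. $\mathfrak{T}_{09}$: $e_1e_1=e_1$, $e_2e_2=e_2$. $\mathfrak{T}_{10}(\alpha)$, $\alpha\in\mathbf{k}$: $e_1e_1=e_1$, $e_1e_2=(1-\alpha)e_1+\alpha e_2$, $e_2e_1=\alpha e_1+(1-\alpha)e_2$, $e_2e_2=e_2$. $\mathfrak{T}_{07}( * )$, $\mathfrak{T}_{08}( * )$, $\mathfrak{T}_{10}( * )$ denote the families of all $\mathfrak{T}_{07}(\alpha)$, $\mathfrak{T}_{08}(\alpha)$, $\mathfrak{T}_{10}(\alpha)$ with $\alpha$ in the indicated ranges. *)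

theory Defs
  imports "HOL-Analysis.Analysis" "HOL-Computational_Algebra.Polynomial"
begin

definition irreducible_space :: "'a topology \<Rightarrow> bool" where
  "irreducible_space X \<longleftrightarrow> topspace X \<noteq> {} \<and>
     (\<forall>C D. closedin X C \<and> closedin X D \<and> C \<union> D = topspace X
        \<longrightarrow> C = topspace X \<or> D = topspace X)"

definition irreducible_in :: "'a topology \<Rightarrow> 'a set \<Rightarrow> bool" where
  "irreducible_in X S \<longleftrightarrow> S \<subseteq> topspace X \<and> irreducible_space (subtopology X S)"

definition irreducible_components :: "'a topology \<Rightarrow> 'a set set" where
  "irreducible_components X =
     {Z. irreducible_in X Z \<and> (\<forall>W. irreducible_in X W \<and> Z \<subseteq> W \<longrightarrow> W = Z)}"

type_synonym 'k mult = "'k^2 \<Rightarrow> 'k^2 \<Rightarrow> 'k^2"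

definition mults :: "'k::field mult set" where
  "mults = {\<mu>. (\<forall>x. Vector_Spaces.linear (*s) (*s) (\<mu> x)) \<and>
               (\<forall>y. Vector_Spaces.linear (*s) (*s) (\<lambda>x. \<mu> x y))}"

definition GL :: "('k::field^2 \<Rightarrow> 'k^2) set" where
  "GL = {g. Vector_Spaces.linear (*s) (*s) g \<and> bij g}"

definition act :: "('k^2 \<Rightarrow> 'k^2) \<Rightarrow> 'k mult \<Rightarrow> 'k mult" where
  "act g \<mu> = (\<lambda>x y. g (\<mu> (inv g x) (inv g y)))"

definition orbit :: "'k::field mult \<Rightarrow> 'k mult set" where
  "orbit \<mu> = {act g \<mu> | g. g \<in> GL}"

text \<open>Polynomials in the eight structure constants, i.e. in the coordinates identifying
  \<open>mults\<close> with affine 8-space. They are total on the function type, so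
  \<open>zero_locus\<close> below restricts to \<open>mults\<close>.\<close>

inductive_set polynomial_functions :: "('k::field mult \<Rightarrow> 'k) set" where
  const: "(\<lambda>_. c) \<in> polynomial_functions"
| coord: "(\<lambda>\<mu>. \<mu> (axis i 1) (axis j 1) $ l) \<in> polynomial_functions"
| add: "f \<in> polynomial_functions \<Longrightarrow> h \<in> polynomial_functions
          \<Longrightarrow> (\<lambda>\<mu>. f \<mu> + h \<mu>) \<in> polynomial_functions"
| mult: "f \<in> polynomial_functions \<Longrightarrow> h \<in> polynomial_functions
          \<Longrightarrow> (\<lambda>\<mu>. f \<mu> * h \<mu>) \<in> polynomial_functions"

definition zero_locus :: "('k::field mult \<Rightarrow> 'k) set \<Rightarrow> 'k mult set" where
  "zero_locus F = {\<mu> \<in> mults. \<forall>f\<in>F. f \<mu> = 0}"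

definition zariski :: "'k::field mult topology" where
  "zariski = topology (\<lambda>U. \<exists>F \<subseteq> polynomial_functions. U = mults - zero_locus F)"

lemma istopology_zariski:
  "istopology (\<lambda>U. \<exists>F \<subseteq> polynomial_functions. U = mults - zero_locus (F :: ('k::field mult \<Rightarrow> 'k) set))"
  unfolding istopology_def
proof (intro conjI allI impI)
  fix S T :: "'k mult set"
  assume "\<exists>F\<subseteq>polynomial_functions. S = mults - zero_locus F"
    and "\<exists>F\<subseteq>polynomial_functions. T = mults - zero_locus F"
  then obtain F G where F: "F \<subseteq> polynomial_functions" "S = mults - zero_locus F"
    and G: "G \<subseteq> polynomial_functions" "T = mults - zero_locus G"
    by blast
  define H where "H = {\<lambda>\<mu>. f \<mu> * h \<mu> | f h. f \<in> F \<and> h \<in> G}"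
  have "H \<subseteq> polynomial_functions"
    unfolding H_def using F(1) G(1) by (auto intro!: polynomial_functions.mult)
  moreover have "zero_locus H = zero_locus F \<union> zero_locus G"
  proof
    show "zero_locus H \<subseteq> zero_locus F \<union> zero_locus G"
    proof
      fix \<mu> assume \<mu>: "\<mu> \<in> zero_locus H"
      have "f \<mu> * h \<mu> = 0" if "f \<in> F" "h \<in> G" for f h
      proof -
        have "(\<lambda>\<mu>. f \<mu> * h \<mu>) \<in> H"
          using that unfolding H_def by blast
        with \<mu> show ?thesis
          by (auto simp: zero_locus_def)
      qed
      then show "\<mu> \<in> zero_locus F \<union> zero_locus G"
        using \<mu> unfolding zero_locus_def by auto
    qed
    show "zero_locus F \<union> zero_locus G \<subseteq> zero_locus H"
      by (auto simp: zero_locus_def H_def)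
  qed
  ultimately show "\<exists>F\<subseteq>polynomial_functions. S \<inter> T = mults - zero_locus F"
    using F(2) G(2) by blast
next
  fix K :: "'k mult set set"
  assume "\<forall>S\<in>K. \<exists>F\<subseteq>polynomial_functions. S = mults - zero_locus F"
  then obtain F where F: "\<forall>S\<in>K. F S \<subseteq> polynomial_functions \<and> S = mults - zero_locus (F S)"
    by (rule bchoice[THEN exE])
  have "\<Union>K = mults - zero_locus (\<Union>S\<in>K. F S)"
  proof -
    have "(\<Union>S\<in>K. mults - zero_locus (F S)) = (\<Union>S\<in>K. S)"
      using F by (intro SUP_cong) auto
    then have "\<Union>K = (\<Union>S\<in>K. mults - zero_locus (F S))"
      by simp
    also have "\<dots> = mults - zero_locus (\<Union>S\<in>K. F S)"
      by (auto simp: zero_locus_def)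
    finally show ?thesis .
  qed
  moreover have "(\<Union>S\<in>K. F S) \<subseteq> polynomial_functions"
    using F by blast
  ultimately show "\<exists>F\<subseteq>polynomial_functions. \<Union>K = mults - zero_locus F"
    by blast
qed

lemma openin_zariski:
  "openin zariski U \<longleftrightarrow> (\<exists>F \<subseteq> polynomial_functions. U = mults - zero_locus F)"
  by (simp add: zariski_def topology_inverse'[OF istopology_zariski])

lemma topspace_zariski: "topspace zariski = (mults :: 'k::field mult set)"
proof
  show "topspace zariski \<subseteq> (mults :: 'k mult set)"
    by (auto simp: topspace_def openin_zariski)
  have "mults - zero_locus {\<lambda>_. 1} = (mults :: 'k mult set)"
    by (auto simp: zero_locus_def)
  then have "openin zariski (mults :: 'k mult set)"
    unfolding openin_zariski
    by (intro exI[of _ "{\<lambda>_. 1}"]) (auto intro: polynomial_functions.const)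
  then show "(mults :: 'k mult set) \<subseteq> topspace zariski"
    by (rule openin_subset)
qed

lemma closedin_zariski:
  "closedin zariski Z \<longleftrightarrow> (\<exists>F \<subseteq> polynomial_functions. Z = zero_locus F)"
proof
  assume "closedin zariski Z"
  then have "Z \<subseteq> mults" "openin zariski (mults - Z)"
    by (simp_all add: closedin_def topspace_zariski)
  then obtain F where F: "F \<subseteq> polynomial_functions" "mults - Z = mults - zero_locus F"
    by (auto simp: openin_zariski)
  have "zero_locus F \<subseteq> mults"
    by (auto simp: zero_locus_def)
  with \<open>Z \<subseteq> mults\<close> F(2) have "Z = zero_locus F"
    by blast
  with F(1) show "\<exists>F \<subseteq> polynomial_functions. Z = zero_locus F"
    by blast
next
  assume "\<exists>F \<subseteq> polynomial_functions. Z = zero_locus F"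
  then obtain F where F: "F \<subseteq> polynomial_functions" "Z = zero_locus F"
    by blast
  have "openin zariski (mults - Z)"
    unfolding openin_zariski using F by blast
  moreover have "Z \<subseteq> mults"
    using F(2) by (auto simp: zero_locus_def)
  ultimately show "closedin zariski Z"
    by (simp add: closedin_def topspace_zariski)
qed

text \<open>The single overloaded bracket of the terminal identity is split by the types of its
  arguments: [bilinear, vector], [linear, bilinear], [bilinear, bilinear].\<close>

definition bracket_vec :: "'k mult \<Rightarrow> 'k^2 \<Rightarrow> ('k^2 \<Rightarrow> 'k^2)" where
  "bracket_vec A a = (\<lambda>x. A a x)"

definition bracket_lin :: "('k::field^2 \<Rightarrow> 'k^2) \<Rightarrow> 'k mult \<Rightarrow> 'k mult" where
  "bracket_lin A B = (\<lambda>x y. A (B x y) - B (A x) y - B x (A y))"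

definition bracket_bil :: "'k::field mult \<Rightarrow> 'k mult \<Rightarrow> ('k^2 \<Rightarrow> 'k^2 \<Rightarrow> 'k^2 \<Rightarrow> 'k^2)" where
  "bracket_bil A B = (\<lambda>x y z.
      A (B x y) z + A x (B y z) + A y (B x z) - B (A x y) z - B x (A y z) - B y (A x z))"

definition terminal :: "'k::field mult \<Rightarrow> bool" where
  "terminal P \<longleftrightarrow>
     (\<forall>a. bracket_bil (bracket_lin (bracket_vec P a) P) P = (\<lambda>x y z. 0))"

definition terminal_mults :: "'k::field mult set" where
  "terminal_mults = {P \<in> mults. terminal P}"

definition e1 :: "'k::field^2" where "e1 = axis 1 1"
definition e2 :: "'k::field^2" where "e2 = axis 2 1"

text \<open>The arguments are the products of basis vectors
  \<open>e1 e1\<close>, \<open>e1 e2\<close>, \<open>e2 e1\<close>, \<open>e2 e2\<close>, in this order.\<close>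

definition mult_table :: "'k::field^2 \<Rightarrow> 'k^2 \<Rightarrow> 'k^2 \<Rightarrow> 'k^2 \<Rightarrow> 'k mult" where
  "mult_table p q r s = (\<lambda>x y.
     (x$1 * y$1) *s p + (x$1 * y$2) *s q + (x$2 * y$1) *s r + (x$2 * y$2) *s s)"

definition zero_alg :: "'k::field mult" where
  "zero_alg = mult_table 0 0 0 0"
definition T01 :: "'k::field mult" where
  "T01 = mult_table (e1 + e2) e2 0 0"
definition T02 :: "'k::field mult" where
  "T02 = mult_table (e1 + e2) (2 *s e2) (- e2) 0"
definition T03 :: "'k::field mult" where
  "T03 = mult_table e2 0 0 0"
definition T04 :: "'k::field mult" where
  "T04 = mult_table 0 0 e1 0"
definition T05 :: "'k::field mult" where
  "T05 = mult_table 0 (2 *s e1) (- e1) 0"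
definition T06 :: "'k::field mult" where
  "T06 = mult_table 0 e2 (- e2) 0"
definition T07 :: "'k::field \<Rightarrow> 'k mult" where
  "T07 \<alpha> = mult_table e1 (\<alpha> *s e2) 0 0"
definition T08 :: "'k::field \<Rightarrow> 'k mult" where
  "T08 \<alpha> = mult_table e1 (\<alpha> *s e2) ((3 - 2 * \<alpha>) *s e2) 0"
definition T09 :: "'k::field mult" where
  "T09 = mult_table e1 0 0 e2"
definition T10 :: "'k::field \<Rightarrow> 'k mult" where
  "T10 \<alpha> = mult_table e1 ((1 - \<alpha>) *s e1 + \<alpha> *s e2) (\<alpha> *s e1 + (1 - \<alpha>) *s e2) e2"

definition orbits_T07 :: "'k::field mult set" where
  "orbits_T07 = (\<Union>\<alpha>\<in>- {1}. orbit (T07 \<alpha>))"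
definition orbits_T08 :: "'k::field mult set" where
  "orbits_T08 = (\<Union>\<alpha>\<in>- {2, 3 / 2}. orbit (T08 \<alpha>))"
definition orbits_T10 :: "'k::field mult set" where
  "orbits_T10 = (\<Union>\<alpha>. orbit (T10 \<alpha>))"

end

theory Submission
  imports Defs
begin

text \<open>Every family is squeezed between an irreducible set and a closed one. A multiplication in
  one of the families has a distinguished linear form \<open>f\<close>, with kernel spanned by \<open>w\<close>, and in a
  basis \<open>u\<close>, \<open>w\<close> with \<open>f u = 1\<close> its table is triangular: \<open>uu = l u + c w\<close>, \<open>uw = b w\<close>, \<open>wu = g w\<close>,
  \<open>ww = 0\<close>, where \<open>g = 0\<close> for the family of \<open>T07\<close>, \<open>g = 3 l - 2 b\<close> for that of \<open>T08\<close>, and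
  \<open>c = 0\<close>, \<open>l = b + g\<close> for that of \<open>T10\<close>. Such multiplications are polynomially parametrized by
  \<open>f\<close> and a few scalars, and any two points of a parameter space are joined by a line, which
  gives irreducibility. On the other hand, \<open>f\<close> solves a system of linear equations whose
  coefficients are linear in the structure constants, so its existence is the vanishing of
  \<open>2 \<times> 2\<close> minors, which gives closedness. The closure of the orbit of \<open>T09\<close> consists of the
  commutative associative multiplications. Degenerations are limits along polynomial curves of
  triangular tables.

  For the decomposition of the terminal multiplications, the cubic form \<open>x \<and> xx\<close> has a zero
  over an algebraically closed field, so there is an idempotent or a nonzero element of square
  zero; in a basis starting with it, the coefficients of the terminal identity factor into linear
  forms that separate the four families.\<close>

section \<open>Irreducible sets\<close>

lemma irreducible_inD:
  assumes "irreducible_in X S" "closedin X C" "closedin X D" "S \<subseteq> C \<union> D"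
  shows "S \<subseteq> C \<or> S \<subseteq> D"
proof -
  have top: "topspace (subtopology X S) = S"
    using assms(1) by (auto simp: irreducible_in_def)
  have "closedin (subtopology X S) (C \<inter> S)" "closedin (subtopology X S) (D \<inter> S)"
    using assms(2,3) by (auto simp: closedin_subtopology)
  moreover have "C \<inter> S \<union> D \<inter> S = S"
    using assms(4) by blast
  ultimately have "C \<inter> S = S \<or> D \<inter> S = S"
    using assms(1) top unfolding irreducible_in_def irreducible_space_def by metis
  then show ?thesis
    by blast
qed

lemma irreducible_inI:
  assumes "S \<subseteq> topspace X" "S \<noteq> {}"
    and "\<And>C D. closedin X C \<Longrightarrow> closedin X D \<Longrightarrow> S \<subseteq> C \<union> D \<Longrightarrow> S \<subseteq> C \<or> S \<subseteq> D"
  shows "irreducible_in X S"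
proof -
  have top: "topspace (subtopology X S) = S"
    using assms(1) by auto
  have "C = S \<or> D = S"
    if C: "closedin (subtopology X S) C" and D: "closedin (subtopology X S) D" and "C \<union> D = S" for C D
  proof -
    obtain C' D' where "closedin X C'" "C = C' \<inter> S" "closedin X D'" "D = D' \<inter> S"
      using C D by (auto simp: closedin_subtopology)
    moreover from this have "S \<subseteq> C' \<union> D'"
      using \<open>C \<union> D = S\<close> by blast
    ultimately show ?thesis
      using assms(3)[of C' D'] by blast
  qed
  then show ?thesis
    using assms(1,2) top by (simp add: irreducible_in_def irreducible_space_def)
qed

lemma irreducible_in_nonempty: "irreducible_in X S \<Longrightarrow> S \<noteq> {}"
  by (auto simp: irreducible_in_def irreducible_space_def)

lemma irreducible_in_subtopology:
  "irreducible_in (subtopology X S) Z \<longleftrightarrow> irreducible_in X Z \<and> Z \<subseteq> S"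
  by (auto simp: irreducible_in_def subtopology_subtopology Int_absorb1)

text \<open>A closed set containing \<open>S\<close> contains its closure, so a closed cover of the
  closure is decided already on \<open>S\<close>.\<close>

lemma irreducible_in_closure_of:
  assumes "irreducible_in X S"
  shows "irreducible_in X (X closure_of S)"
proof (rule irreducible_inI)
  have S: "S \<subseteq> topspace X"
    using assms by (simp add: irreducible_in_def)
  then have sub: "S \<subseteq> X closure_of S"
    by (rule closure_of_subset)
  show "X closure_of S \<subseteq> topspace X"
    by (rule closure_of_subset_topspace)
  show "X closure_of S \<noteq> {}"
    using sub irreducible_in_nonempty[OF assms] by blast
  fix C D assume "closedin X C" "closedin X D" "X closure_of S \<subseteq> C \<union> D"
  then show "X closure_of S \<subseteq> C \<or> X closure_of S \<subseteq> D"
    using irreducible_inD[OF assms, of C D] sub by (meson closure_of_minimal order_trans)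
qed

text \<open>Irreducibility peels off one closed set at a time, the union of the remaining ones being
  closed.\<close>

lemma irreducible_in_subset_Union:
  assumes "finite \<Z>" "irreducible_in X W" "\<And>Z. Z \<in> \<Z> \<Longrightarrow> closedin X Z" "W \<subseteq> \<Union>\<Z>"
  shows "\<exists>Z\<in>\<Z>. W \<subseteq> Z"
  using assms
proof (induction \<Z> rule: finite_induct)
  case empty
  then show ?case
    using irreducible_in_nonempty by fastforce
next
  case (insert Z \<Z>)
  have "closedin X (\<Union>\<Z>)"
    using insert by (intro closedin_Union) auto
  then have "W \<subseteq> Z \<or> W \<subseteq> \<Union>\<Z>"
    using irreducible_inD[OF insert.prems(1), of Z "\<Union>\<Z>"] insert.prems by auto
  then show ?case
    using insert by auto
qed

text \<open>Any irreducible subset of the union lies in a single member of \<open>\<Z>\<close>. So a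
  maximal one is a member, and since no member contains another, each member is maximal.\<close>

lemma irreducible_components_subtopology_eq:
  assumes "finite \<Z>"
    and closed: "\<And>Z. Z \<in> \<Z> \<Longrightarrow> closedin X Z"
    and irred: "\<And>Z. Z \<in> \<Z> \<Longrightarrow> irreducible_in X Z"
    and antichain: "\<And>Y Z. Y \<in> \<Z> \<Longrightarrow> Z \<in> \<Z> \<Longrightarrow> Y \<subseteq> Z \<Longrightarrow> Y = Z"
  shows "irreducible_components (subtopology X (\<Union>\<Z>)) = \<Z>"
proof
  show "irreducible_components (subtopology X (\<Union>\<Z>)) \<subseteq> \<Z>"
  proof
    fix W assume "W \<in> irreducible_components (subtopology X (\<Union>\<Z>))"
    then have W: "irreducible_in X W" "W \<subseteq> \<Union>\<Z>"
      and max: "\<And>V. irreducible_in X V \<Longrightarrow> V \<subseteq> \<Union>\<Z> \<Longrightarrow> W \<subseteq> V \<Longrightarrow> V = W"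
      by (auto simp: irreducible_components_def irreducible_in_subtopology)
    obtain Z where Z: "Z \<in> \<Z>" "W \<subseteq> Z"
      using irreducible_in_subset_Union[OF assms(1) W(1) closed W(2)] by blast
    then have "Z = W"
      by (intro max irred) auto
    with Z show "W \<in> \<Z>"
      by simp
  qed
  show "\<Z> \<subseteq> irreducible_components (subtopology X (\<Union>\<Z>))"
  proof
    fix Z assume Z: "Z \<in> \<Z>"
    have "W = Z" if W: "irreducible_in X W" "W \<subseteq> \<Union>\<Z>" "Z \<subseteq> W" for W
    proof -
      obtain Y where "Y \<in> \<Z>" "W \<subseteq> Y"
        using irreducible_in_subset_Union[OF assms(1) W(1) closed W(2)] by blast
      with W(3) antichain[OF Z] show ?thesis
        by blast
    qed
    then show "Z \<in> irreducible_components (subtopology X (\<Union>\<Z>))"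
      using Z irred by (auto simp: irreducible_components_def irreducible_in_subtopology)
  qed
qed

section \<open>Polynomial curves\<close>

definition polynomial_map :: "('k::comm_ring_1 \<Rightarrow> 'k) \<Rightarrow> bool" where
  "polynomial_map h \<longleftrightarrow> (\<exists>p. \<forall>t. h t = poly p t)"

named_theorems polynomial_map_intros

lemma polynomial_map_const [polynomial_map_intros]: "polynomial_map (\<lambda>t. c)"
  unfolding polynomial_map_def by (intro exI[of _ "[:c:]"]) simp

lemma polynomial_map_id [polynomial_map_intros]: "polynomial_map (\<lambda>t. t)"
  unfolding polynomial_map_def by (intro exI[of _ "[:0, 1:]"]) simp

lemma polynomial_map_add [polynomial_map_intros]:
  "polynomial_map f \<Longrightarrow> polynomial_map g \<Longrightarrow> polynomial_map (\<lambda>t. f t + g t)"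
  unfolding polynomial_map_def by (metis poly_add)

lemma polynomial_map_mult [polynomial_map_intros]:
  "polynomial_map f \<Longrightarrow> polynomial_map g \<Longrightarrow> polynomial_map (\<lambda>t. f t * g t)"
  unfolding polynomial_map_def by (metis poly_mult)

lemma polynomial_map_diff [polynomial_map_intros]:
  "polynomial_map f \<Longrightarrow> polynomial_map g \<Longrightarrow> polynomial_map (\<lambda>t. f t - g t)"
  unfolding polynomial_map_def by (metis poly_diff)

lemma polynomial_map_minus [polynomial_map_intros]:
  "polynomial_map f \<Longrightarrow> polynomial_map (\<lambda>t. - f t)"
  unfolding polynomial_map_def by (metis poly_minus)

lemma polynomial_map_finite_roots:
  fixes h :: "'k::idom \<Rightarrow> 'k"
  assumes "polynomial_map h" "h s \<noteq> 0"
  shows "finite {t. h t = 0}"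
proof -
  obtain p where p: "\<And>t. h t = poly p t"
    using assms(1) by (auto simp: polynomial_map_def)
  then have "p \<noteq> 0"
    using assms(2) by auto
  then show ?thesis
    using poly_roots_finite[of p] p by simp
qed

definition polynomial_curve :: "('k::field \<Rightarrow> 'k mult) \<Rightarrow> bool" where
  "polynomial_curve c \<longleftrightarrow>
     (\<forall>t. c t \<in> mults) \<and> (\<forall>i j l. polynomial_map (\<lambda>t. c t (axis i 1) (axis j 1) $ l))"

lemma polynomial_map_polynomial_curve:
  assumes "polynomial_curve c" "f \<in> polynomial_functions"
  shows "polynomial_map (\<lambda>t. f (c t))"
  using assms(2)
  by induction (use assms(1) in \<open>auto simp: polynomial_curve_def intro: polynomial_map_intros\<close>)

lemma polynomial_curve_finite_zeros:
  assumes "polynomial_curve c" "f \<in> polynomial_functions" "f (c s) \<noteq> 0"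
  shows "finite {t. f (c t) = 0}"
  using polynomial_map_finite_roots[OF polynomial_map_polynomial_curve, OF assms(1,2), of s] assms(3)
  by simp

text \<open>A polynomial function vanishing on \<open>S\<close> vanishes along the curve at all but
  finitely many parameters. A field of characteristic zero is infinite, so it vanishes along the
  whole curve, also at \<open>c s\<close>.\<close>

lemma polynomial_curve_mem_closure:
  fixes c :: "'k::field_char_0 \<Rightarrow> 'k mult"
  assumes c: "polynomial_curve c" and fin: "finite {t. c t \<notin> S}"
  shows "c s \<in> zariski closure_of S"
proof -
  have "c s \<in> K" if K: "closedin zariski K" "S \<inter> mults \<subseteq> K" for K
  proof -
    obtain F where F: "F \<subseteq> polynomial_functions" "K = zero_locus F"
      using K(1) by (auto simp: closedin_zariski)
    have "f (c s) = 0" if f: "f \<in> F" for f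
    proof (rule ccontr)
      assume "f (c s) \<noteq> 0"
      then have "finite {t. f (c t) = 0}"
        using F(1) f polynomial_curve_finite_zeros[OF c] by blast
      moreover have "UNIV \<subseteq> {t. f (c t) = 0} \<union> {t. c t \<notin> S}"
        using F f K(2) c by (auto simp: zero_locus_def polynomial_curve_def)
      ultimately show False
        using fin infinite_UNIV_char_0 by (meson finite_UnI finite_subset)
    qed
    then show ?thesis
      using c F(2) by (simp add: zero_locus_def polynomial_curve_def)
  qed
  \<comment> \<open>\<open>S\<close> need not lie in \<open>mults\<close>; \<open>closure_of\<close>
    only sees the part inside the space.\<close>
  then have "c s \<in> zariski closure_of (S \<inter> mults)"
    by (metis closedin_closure_of closure_of_subset inf_le2 topspace_zariski)
  then show ?thesis
    by (metis closure_of_restrict inf_commute topspace_zariski)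
qed

text \<open>Two closed sets that cover \<open>S\<close> but neither of which contains it are separated by
  polynomial functions nonvanishing at two points of \<open>S\<close>, whose product vanishes on the curve
  joining these points.\<close>

lemma irreducible_in_zariskiI:
  fixes S :: "'k::field_char_0 mult set"
  assumes "S \<noteq> {}" "S \<subseteq> mults"
    and curve: "\<And>\<mu> \<nu>. \<mu> \<in> S \<Longrightarrow> \<nu> \<in> S \<Longrightarrow>
      \<exists>c. polynomial_curve c \<and> c 0 = \<mu> \<and> c 1 = \<nu> \<and> finite {t. c t \<notin> S}"
  shows "irreducible_in zariski S"
proof (rule irreducible_inI)
  show "S \<subseteq> topspace zariski"
    using assms(2) by (simp add: topspace_zariski)
  show "S \<noteq> {}"
    by fact
  fix C D assume "closedin zariski C" "closedin zariski D" and cover: "S \<subseteq> C \<union> D"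
  then obtain F G where F: "F \<subseteq> polynomial_functions" "C = zero_locus F"
    and G: "G \<subseteq> polynomial_functions" "D = zero_locus G"
    by (auto simp: closedin_zariski)
  show "S \<subseteq> C \<or> S \<subseteq> D"
  proof (rule ccontr)
    assume "\<not> (S \<subseteq> C \<or> S \<subseteq> D)"
    then obtain \<mu> \<nu> where "\<mu> \<in> S" "\<mu> \<notin> C" "\<nu> \<in> S" "\<nu> \<notin> D"
      by blast
    then obtain f g where f: "f \<in> F" "f \<mu> \<noteq> 0" and g: "g \<in> G" "g \<nu> \<noteq> 0"
      using F G assms(2) by (auto simp: zero_locus_def)
    obtain c where c: "polynomial_curve c" "c 0 = \<mu>" "c 1 = \<nu>" "finite {t. c t \<notin> S}"
      using curve[OF \<open>\<mu> \<in> S\<close> \<open>\<nu> \<in> S\<close>] by blast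
    have "finite {t. f (c t) = 0}"
      using f F(1) c(2) polynomial_curve_finite_zeros[OF c(1)] by blast
    moreover have "finite {t. g (c t) = 0}"
      using g G(1) c(3) polynomial_curve_finite_zeros[OF c(1)] by blast
    moreover have "UNIV \<subseteq> {t. f (c t) = 0} \<union> {t. g (c t) = 0} \<union> {t. c t \<notin> S}"
      using cover F(2) G(2) f(1) g(1) by (auto simp: zero_locus_def)
    ultimately show False
      using c(4) infinite_UNIV_char_0 by (meson finite_UnI finite_subset)
  qed
qed

section \<open>Closed sets from polynomial equations and linear systems\<close>

lemma polynomial_functions_diff:
  "f \<in> polynomial_functions \<Longrightarrow> g \<in> polynomial_functions \<Longrightarrow> (\<lambda>\<mu>. f \<mu> - g \<mu>) \<in> polynomial_functions"
  using polynomial_functions.add[OF _ polynomial_functions.mult[OF polynomial_functions.const[of "-1"]], of f g]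
  by simp

lemma closedin_zariski_zeros:
  assumes "\<And>i. i \<in> I \<Longrightarrow> f i \<in> polynomial_functions"
  shows "closedin zariski {\<mu> \<in> mults. \<forall>i\<in>I. f i \<mu> = 0}"
  unfolding closedin_zariski zero_locus_def using assms by (intro exI[of _ "f ` I"]) auto

text \<open>A nonzero solution means that the matrix with rows \<open>a i\<close>,
  \<open>b i\<close> has rank at most one, that is, all its 2 by 2 minors vanish. This trades an
  existential quantifier for polynomial equations.\<close>

lemma common_kernel_iff:
  fixes a b :: "'i \<Rightarrow> 'k::field"
  shows "(\<exists>p q. (p \<noteq> 0 \<or> q \<noteq> 0) \<and> (\<forall>i\<in>I. a i * p + b i * q = 0)) \<longleftrightarrow>
    (\<forall>i\<in>I. \<forall>j\<in>I. a i * b j - a j * b i = 0)" (is "?L \<longleftrightarrow> ?R")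
proof
  assume ?L
  then obtain p q where pq: "p \<noteq> 0 \<or> q \<noteq> 0" "\<And>i. i \<in> I \<Longrightarrow> a i * p + b i * q = 0"
    by blast
  show ?R
  proof (intro ballI)
    fix i j assume "i \<in> I" "j \<in> I"
    then have "a i * p + b i * q = 0" "a j * p + b j * q = 0"
      using pq(2) by auto
    then have "(a i * b j - a j * b i) * p = 0" "(a i * b j - a j * b i) * q = 0"
      by algebra+
    then show "a i * b j - a j * b i = 0"
      using pq(1) by auto
  qed
next
  assume R: ?R
  show ?L
  proof (cases "\<exists>j\<in>I. a j \<noteq> 0 \<or> b j \<noteq> 0")
    case True
    then obtain j where "j \<in> I" "a j \<noteq> 0 \<or> b j \<noteq> 0"
      by blast
    \<comment> \<open>The vector \<open>(b j, - a j)\<close> is killed by the nonzero row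
      \<open>j\<close>, and every other row is proportional to that one.\<close>
    moreover have "a i * b j + b i * - a j = 0" if "i \<in> I" for i
      using R \<open>j \<in> I\<close> that by (auto simp: algebra_simps)
    ultimately show ?thesis
      by (intro exI[of _ "b j"] exI[of _ "- a j"]) auto
  next
    case False
    then show ?thesis
      by (intro exI[of _ 1]) auto
  qed
qed

lemma closedin_zariski_common_kernel:
  assumes "\<And>i. i \<in> I \<Longrightarrow> A i \<in> polynomial_functions" "\<And>i. i \<in> I \<Longrightarrow> B i \<in> polynomial_functions"
  shows "closedin zariski
    {\<mu> \<in> mults. \<exists>p q. (p \<noteq> 0 \<or> q \<noteq> 0) \<and> (\<forall>i\<in>I. A i \<mu> * p + B i \<mu> * q = 0)}"
proof -
  define D where "D = (\<lambda>(i, j) \<mu>. A i \<mu> * B j \<mu> - A j \<mu> * B i \<mu>)"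
  have "D x \<in> polynomial_functions" if "x \<in> I \<times> I" for x
    using assms that
    by (auto simp: D_def intro!: polynomial_functions_diff polynomial_functions.mult)
  then have "closedin zariski {\<mu> \<in> mults. \<forall>x\<in>I \<times> I. D x \<mu> = 0}"
    by (rule closedin_zariski_zeros)
  then show ?thesis
    unfolding common_kernel_iff by (simp add: D_def)
qed

section \<open>Multiplications and orbits\<close>

lemma linear_vec_iff:
  "Vector_Spaces.linear (*s) (*s) (f :: 'k::field^2 \<Rightarrow> 'k^2) \<longleftrightarrow>
    (\<forall>x y. f (x + y) = f x + f y) \<and> (\<forall>c x. f (c *s x) = c *s f x)"
  by (simp add: Vector_Spaces.linear_iff vec.vector_space_axioms)

lemma vec2_eq_iff: "x = y \<longleftrightarrow> x$1 = y$1 \<and> x$2 = y$2" for x y :: "'k^2"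
  by (simp add: vec_eq_iff forall_2)

lemma e1_nth [simp]: "e1 $ 1 = 1" "e1 $ 2 = 0"
  and e2_nth [simp]: "e2 $ 1 = 0" "e2 $ 2 = 1"
  by (simp_all add: e1_def e2_def axis_def)

lemma vec2_expand: "x = x$1 *s e1 + x$2 *s e2"
  by (simp add: vec2_eq_iff)

lemma mult_table_mem_mults [simp]: "mult_table p q r s \<in> mults"
  by (simp add: mults_def linear_vec_iff mult_table_def vec2_eq_iff algebra_simps)

lemma mults_bilinear:
  assumes "\<mu> \<in> mults"
  shows "\<mu> (a *s x + b *s y) (c *s z + d *s w) =
    (a * c) *s \<mu> x z + (a * d) *s \<mu> x w + (b * c) *s \<mu> y z + (b * d) *s \<mu> y w"
proof -
  have "\<mu> u (c *s z + d *s w) = c *s \<mu> u z + d *s \<mu> u w" for u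
    using assms by (simp add: mults_def linear_vec_iff)
  moreover have "\<mu> (a *s x + b *s y) u = a *s \<mu> x u + b *s \<mu> y u" for u
    using assms by (simp add: mults_def linear_vec_iff)
  ultimately show ?thesis
    by (simp add: vec2_eq_iff algebra_simps)
qed

lemma mults_eq_mult_table:
  assumes "\<mu> \<in> mults"
  shows "\<mu> = mult_table (\<mu> e1 e1) (\<mu> e1 e2) (\<mu> e2 e1) (\<mu> e2 e2)"
proof (intro ext)
  fix x y
  show "\<mu> x y = mult_table (\<mu> e1 e1) (\<mu> e1 e2) (\<mu> e2 e1) (\<mu> e2 e2) x y"
    using mults_bilinear[OF assms, of "x$1" e1 "x$2" e2 "y$1" e1 "y$2" e2]
    by (simp add: mult_table_def flip: vec2_expand)
qed

section \<open>Change of basis and orbits\<close>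

definition vdet :: "'k::comm_ring_1^2 \<Rightarrow> 'k^2 \<Rightarrow> 'k" where
  "vdet u v = u$1 * v$2 - v$1 * u$2"

definition basis_map :: "'k::field^2 \<Rightarrow> 'k^2 \<Rightarrow> 'k^2 \<Rightarrow> 'k^2" where
  "basis_map u v = (\<lambda>x. x$1 *s u + x$2 *s v)"

text \<open>Cramer's rule, \<open>vdet\<close> being the determinant.\<close>

lemma basis_map_inverse:
  assumes "vdet u v \<noteq> 0"
  shows "basis_map u v ((vdet x v / vdet u v) *s e1 + (vdet u x / vdet u v) *s e2) = x"
    and "(vdet (basis_map u v x) v / vdet u v) *s e1 + (vdet u (basis_map u v x) / vdet u v) *s e2 = x"
  using assms by (simp_all add: basis_map_def vec2_eq_iff field_simps) (simp_all add: vdet_def algebra_simps)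

lemma bij_basis_map:
  assumes "vdet u v \<noteq> 0"
  shows "bij (basis_map u v)"
  by (rule bij_betw_byWitness[where f' =
        "\<lambda>x. (vdet x v / vdet u v) *s e1 + (vdet u x / vdet u v) *s e2"])
     (simp_all add: basis_map_inverse[OF assms])

lemma inv_basis_map:
  assumes "vdet u v \<noteq> 0"
  shows "inv (basis_map u v) x = (vdet x v / vdet u v) *s e1 + (vdet u x / vdet u v) *s e2"
  by (rule inv_f_eq[OF bij_is_inj[OF bij_basis_map[OF assms]] basis_map_inverse(1)[OF assms]])

lemma basis_map_mem_GL: "vdet u v \<noteq> 0 \<Longrightarrow> basis_map u v \<in> GL"
  by (simp add: GL_def bij_basis_map linear_vec_iff) (simp add: basis_map_def vec2_eq_iff algebra_simps)

lemma GL_cases: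
  assumes "g \<in> GL"
  obtains u v where "vdet u v \<noteq> 0" "g = basis_map u v"
proof
  have lin: "g (a *s x + b *s y) = a *s g x + b *s g y" for a b x y
    using assms by (simp add: GL_def linear_vec_iff)
  show "g = basis_map (g e1) (g e2)"
  proof
    fix x
    show "g x = basis_map (g e1) (g e2) x"
      using lin[of "x$1" e1 "x$2" e2] by (simp add: basis_map_def flip: vec2_expand)
  qed
  have inj: "x = 0" if "g x = 0" for x
    using assms that lin[of 0 0 0 0] by (auto simp: GL_def bij_def dest: injD[of g x 0])
  show "vdet (g e1) (g e2) \<noteq> 0"
  proof
    assume 0: "vdet (g e1) (g e2) = 0"
    \<comment> \<open>If the images of \<open>e1\<close> and \<open>e2\<close> were dependent, these
      combinations, with coordinates of the images as coefficients, would lie in the kernel;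
      injectivity then gives \<open>g e1 = 0\<close>.\<close>
    have "g (g e2 $ i *s e1 + (- g e1 $ i) *s e2) = 0" for i
      using 0 exhaust_2[of i] unfolding lin by (auto simp: vec2_eq_iff vdet_def algebra_simps)
    then have "g e2 $ i *s e1 + (- g e1 $ i) *s e2 = 0" for i
      by (rule inj)
    then have "g e1 = 0"
      by (simp add: vec2_eq_iff)
    then show False
      using inj[of e1] by (simp add: vec2_eq_iff)
  qed
qed

lemma act_mem_mults:
  assumes "g \<in> GL" "\<mu> \<in> mults"
  shows "act g \<mu> \<in> mults"
proof -
  obtain u v where uv: "vdet u v \<noteq> 0" "g = basis_map u v"
    using GL_cases[OF assms(1)] .
  have "\<mu> (inv g (a *s x + b *s y)) (inv g (c *s z + d *s w)) =
    (a * c) *s \<mu> (inv g x) (inv g z) + (a * d) *s \<mu> (inv g x) (inv g w)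
    + (b * c) *s \<mu> (inv g y) (inv g z) + (b * d) *s \<mu> (inv g y) (inv g w)" for a b c d x y z w
  proof -
    have "inv g (a *s x + b *s y) = a *s inv g x + b *s inv g y" for a b x y
      using uv by (simp add: inv_basis_map vec2_eq_iff vdet_def add_divide_distrib diff_divide_distrib algebra_simps)
    then show ?thesis
      by (simp add: mults_bilinear[OF assms(2)])
  qed
  note bil = this
  have lin: "g (a *s x) = a *s g x" "g (x + y) = g x + g y" for a x y
    using assms(1) by (simp_all add: GL_def linear_vec_iff)
  show ?thesis
    \<comment> \<open>Zeros and ones among the scalars give additivity and homogeneity in each
      argument.\<close>
    using bil[of 1 _ 1] bil[of _ _ 0 _ 1 _ 0] bil[of 1 _ 0 _ _ _ 0] bil[of 1 _ 0 _ 1 _ 1] bil[of 1 _ 1 _ 1 _ 0]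
    by (simp add: mults_def linear_vec_iff act_def lin)
qed

lemma orbit_subset_mults: "\<mu> \<in> mults \<Longrightarrow> orbit \<mu> \<subseteq> mults"
  by (auto simp: orbit_def act_mem_mults)

text \<open>Lying in the orbit means having the given table in some basis \<open>u\<close>,
  \<open>v\<close>. This keeps \<open>inv\<close> and the group action out of later orbit
  computations.\<close>

lemma mem_orbit_mult_table_iff:
  "\<mu> \<in> orbit (mult_table p q r s) \<longleftrightarrow> \<mu> \<in> mults \<and> (\<exists>u v. vdet u v \<noteq> 0 \<and>
     \<mu> u u = basis_map u v p \<and> \<mu> u v = basis_map u v q \<and>
     \<mu> v u = basis_map u v r \<and> \<mu> v v = basis_map u v s)" (is "?L \<longleftrightarrow> ?R")
proof
  assume ?L
  then obtain g where g: "g \<in> GL" "\<mu> = act g (mult_table p q r s)"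
    by (auto simp: orbit_def)
  obtain u v where uv: "vdet u v \<noteq> 0" "g = basis_map u v"
    using GL_cases[OF g(1)] .
  have "inv g u = e1" "inv g v = e2"
    using uv by (simp_all add: inv_basis_map vec2_eq_iff) (simp_all add: vdet_def)
  then have "\<mu> u u = g p" "\<mu> u v = g q" "\<mu> v u = g r" "\<mu> v v = g s"
    by (simp_all add: g act_def mult_table_def)
  then show ?R
    using uv g act_mem_mults[OF g(1)] by auto
next
  assume ?R
  then obtain u v where \<mu>: "\<mu> \<in> mults" and uv: "vdet u v \<noteq> 0"
    "\<mu> u u = basis_map u v p" "\<mu> u v = basis_map u v q"
    "\<mu> v u = basis_map u v r" "\<mu> v v = basis_map u v s"
    by blast
  define g where "g = basis_map u v"
  have gGL: "g \<in> GL"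
    unfolding g_def by (rule basis_map_mem_GL[OF uv(1)])
  have "\<mu> (g x) (g y) = g (mult_table p q r s x y)" for x y
    using mults_bilinear[OF \<mu>, of "x$1" u "x$2" v "y$1" u "y$2" v] uv
    by (simp add: g_def basis_map_def mult_table_def vec2_eq_iff algebra_simps)
  then have "\<mu> = act g (mult_table p q r s)"
    using gGL by (simp add: act_def fun_eq_iff GL_def flip: \<open>\<And>x y. \<mu> (g x) (g y) = _\<close>)
       (simp add: bij_is_surj surj_f_inv_f)
  then show ?L
    using gGL by (auto simp: orbit_def)
qed

lemma orbit_trans:
  assumes "\<mu> \<in> orbit \<nu>" "\<nu> \<in> orbit \<rho>"
  shows "\<mu> \<in> orbit \<rho>"
proof -
  obtain g h where gh: "g \<in> GL" "\<mu> = act g \<nu>" "h \<in> GL" "\<nu> = act h \<rho>"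
    using assms by (auto simp: orbit_def)
  have "g \<circ> h \<in> GL"
    using gh(1,3) by (auto simp: GL_def linear_vec_iff bij_comp)
  moreover have "\<mu> = act (g \<circ> h) \<rho>"
    using gh by (auto simp: act_def o_inv_distrib GL_def)
  ultimately show ?thesis
    by (auto simp: orbit_def)
qed

lemma orbit_refl: "\<mu> \<in> orbit \<mu>"
proof -
  have "id \<in> GL"
    by (simp add: GL_def linear_vec_iff)
  moreover have "act id \<mu> = \<mu>"
    by (simp add: act_def)
  ultimately show ?thesis
    unfolding orbit_def by (metis (mono_tags, lifting) mem_Collect_eq)
qed

lemma orbit_sym:
  assumes "\<mu> \<in> orbit \<nu>"
  shows "\<nu> \<in> orbit \<mu>"
proof -
  obtain g where g: "g \<in> GL" "\<mu> = act g \<nu>"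
    using assms by (auto simp: orbit_def)
  obtain u v where uv: "vdet u v \<noteq> 0" "g = basis_map u v"
    using GL_cases[OF g(1)] .
  have "bij (inv g)"
    using g(1) by (auto simp: GL_def bij_imp_bij_inv)
  moreover have "Vector_Spaces.linear (*s) (*s) (inv g)"
    using uv by (simp add: linear_vec_iff inv_basis_map vec2_eq_iff vdet_def add_divide_distrib diff_divide_distrib algebra_simps)
  ultimately have "inv g \<in> GL"
    by (simp add: GL_def)
  moreover have "act (inv g) \<mu> = \<nu>"
    using g by (simp add: act_def GL_def bij_is_inj inv_inv_eq)
  ultimately show ?thesis
    unfolding orbit_def by (metis (mono_tags, lifting) mem_Collect_eq)
qed

lemma orbit_eqI: "\<mu> \<in> orbit \<nu> \<Longrightarrow> orbit \<mu> = orbit \<nu>"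
  using orbit_trans orbit_sym by blast

section \<open>Multiplications by their eight structure constants\<close>

definition tab :: "'k \<Rightarrow> 'k \<Rightarrow> 'k \<Rightarrow> 'k \<Rightarrow> 'k \<Rightarrow> 'k \<Rightarrow> 'k \<Rightarrow> 'k \<Rightarrow> 'k::field mult" where
  "tab a1 a2 b1 b2 c1 c2 d1 d2 = mult_table
     (a1 *s e1 + a2 *s e2) (b1 *s e1 + b2 *s e2) (c1 *s e1 + c2 *s e2) (d1 *s e1 + d2 *s e2)"

lemma tab_mem_mults [simp]: "tab a1 a2 b1 b2 c1 c2 d1 d2 \<in> mults"
  by (simp add: tab_def)

lemma tab_nth:
  "tab a1 a2 b1 b2 c1 c2 d1 d2 x y $ 1 =
     x$1 * y$1 * a1 + x$1 * y$2 * b1 + x$2 * y$1 * c1 + x$2 * y$2 * d1"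
  "tab a1 a2 b1 b2 c1 c2 d1 d2 x y $ 2 =
     x$1 * y$1 * a2 + x$1 * y$2 * b2 + x$2 * y$1 * c2 + x$2 * y$2 * d2"
  by (simp_all add: tab_def mult_table_def)

lemma mults_eq_tab:
  assumes "\<mu> \<in> mults"
  shows "\<mu> = tab (\<mu> e1 e1 $ 1) (\<mu> e1 e1 $ 2) (\<mu> e1 e2 $ 1) (\<mu> e1 e2 $ 2)
    (\<mu> e2 e1 $ 1) (\<mu> e2 e1 $ 2) (\<mu> e2 e2 $ 1) (\<mu> e2 e2 $ 2)"
  using mults_eq_mult_table[OF assms] by (simp add: tab_def flip: vec2_expand)

lemma mem_orbit_tabI:
  assumes "\<mu> \<in> mults" "vdet u v \<noteq> 0"
    "\<mu> u u = a1 *s u + a2 *s v" "\<mu> u v = b1 *s u + b2 *s v"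
    "\<mu> v u = c1 *s u + c2 *s v" "\<mu> v v = d1 *s u + d2 *s v"
  shows "\<mu> \<in> orbit (tab a1 a2 b1 b2 c1 c2 d1 d2)"
  unfolding tab_def mem_orbit_mult_table_iff using assms by (auto simp: basis_map_def)

text \<open>All conditions are scalar identities. Positional instantiation takes \<open>u1\<close>,
  \<open>v2\<close>, \<open>v1\<close>, \<open>u2\<close> in this order: \<open>[of 1 1 t 0]\<close>
  is the basis \<open>e1\<close>, \<open>t e1 + e2\<close>, and \<open>[of 1 1 0 t]\<close> is
  \<open>e1 + t e2\<close>, \<open>e2\<close>.\<close>

lemma tab_mem_orbit_tabI:
  assumes "u1 * v2 - v1 * u2 \<noteq> 0"
    "u1 * u1 * a1 + u1 * u2 * b1 + u2 * u1 * c1 + u2 * u2 * d1 = a1' * u1 + a2' * v1"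
    "u1 * u1 * a2 + u1 * u2 * b2 + u2 * u1 * c2 + u2 * u2 * d2 = a1' * u2 + a2' * v2"
    "u1 * v1 * a1 + u1 * v2 * b1 + u2 * v1 * c1 + u2 * v2 * d1 = b1' * u1 + b2' * v1"
    "u1 * v1 * a2 + u1 * v2 * b2 + u2 * v1 * c2 + u2 * v2 * d2 = b1' * u2 + b2' * v2"
    "v1 * u1 * a1 + v1 * u2 * b1 + v2 * u1 * c1 + v2 * u2 * d1 = c1' * u1 + c2' * v1"
    "v1 * u1 * a2 + v1 * u2 * b2 + v2 * u1 * c2 + v2 * u2 * d2 = c1' * u2 + c2' * v2"
    "v1 * v1 * a1 + v1 * v2 * b1 + v2 * v1 * c1 + v2 * v2 * d1 = d1' * u1 + d2' * v1"
    "v1 * v1 * a2 + v1 * v2 * b2 + v2 * v1 * c2 + v2 * v2 * d2 = d1' * u2 + d2' * v2"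
  shows "tab a1 a2 b1 b2 c1 c2 d1 d2 \<in> orbit (tab a1' a2' b1' b2' c1' c2' d1' d2')"
  by (rule mem_orbit_tabI[of _ "u1 *s e1 + u2 *s e2" "v1 *s e1 + v2 *s e2"])
     (use assms in \<open>simp_all add: vdet_def vec2_eq_iff tab_nth\<close>)

lemma table_as_tab:
  "zero_alg = tab 0 0 0 0 0 0 0 0"
  "T01 = tab 1 1 0 1 0 0 0 0"
  "T02 = tab 1 1 0 2 0 (-1) 0 0"
  "T03 = tab 0 1 0 0 0 0 0 0"
  "T04 = tab 0 0 0 0 1 0 0 0"
  "T05 = tab 0 0 2 0 (-1) 0 0 0"
  "T06 = tab 0 0 0 1 0 (-1) 0 0"
  "T07 \<alpha> = tab 1 0 0 \<alpha> 0 0 0 0"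
  "T08 \<alpha> = tab 1 0 0 \<alpha> 0 (3 - 2 * \<alpha>) 0 0"
  "T09 = tab 1 0 0 0 0 0 0 1"
  "T10 \<alpha> = tab 1 0 (1 - \<alpha>) \<alpha> \<alpha> (1 - \<alpha>) 0 1"
  unfolding zero_alg_def T01_def T02_def T03_def T04_def T05_def T06_def T07_def T08_def T09_def
    T10_def tab_def
  by (simp_all add: fun_eq_iff mult_table_def vec2_eq_iff)

section \<open>Triangular tables\<close>

definition tri :: "'k \<Rightarrow> 'k \<Rightarrow> 'k \<Rightarrow> 'k \<Rightarrow> 'k::field mult" where
  "tri l c b g = tab l c 0 b 0 g 0 0"

lemma tri_mem_mults [simp]: "tri l c b g \<in> mults"
  by (simp add: tri_def)

lemma orbit_tri_scale:
  assumes "s \<noteq> 0" "r \<noteq> 0"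
  shows "orbit (tri l c b g) = orbit (tri (s * l) (s\<^sup>2 * c / r) (s * b) (s * g))"
  unfolding tri_def
  by (rule orbit_eqI, rule tab_mem_orbit_tabI[of s r 0 0])
     (use assms in \<open>simp_all add: power2_eq_square\<close>)

text \<open>In the basis \<open>e1 + t e2\<close>, \<open>e2\<close> the entry \<open>c\<close>
  moves by \<open>t\<close> times \<open>b + g - l\<close>, so it can be removed unless
  \<open>b + g = l\<close>. This resonance is where \<open>T01\<close> and \<open>T02\<close> come
  from.\<close>

lemma orbit_tri_shear: "orbit (tri l c b g) = orbit (tri l (c + t * (b + g - l)) b g)"
  unfolding tri_def
  by (rule orbit_eqI, rule tab_mem_orbit_tabI[of 1 1 0 t]) (simp_all add: algebra_simps)

lemma orbit_tri_diagonal: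
  assumes "b + g \<noteq> l"
  shows "orbit (tri l c b g) = orbit (tri l 0 b g)"
  using orbit_tri_shear[of l c b g "- c / (b + g - l)"] assms by simp

lemma orbit_tri_normalize:
  assumes "l \<noteq> 0"
  shows "orbit (tri l c b g) = orbit (tri 1 c (b / l) (g / l))"
  using orbit_tri_scale[of "1 / l" "1 / l\<^sup>2" l c b g] assms
  by (simp add: power_divide)

lemma orbit_tri_unit:
  assumes "c \<noteq> 0"
  shows "orbit (tri l c b g) = orbit (tri l 1 b g)"
  using orbit_tri_scale[of 1 c l c b g] assms by simp

text \<open>The vectors \<open>e1\<close> and \<open>e1 + e2\<close> are idempotents of the
  triangular table, and in this basis it becomes \<open>T10 \<alpha>\<close>.\<close>

lemma orbit_T10_eq: "orbit (T10 \<alpha>) = orbit (tri 1 0 \<alpha> (1 - \<alpha>))"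
  unfolding tri_def table_as_tab
  by (rule orbit_eqI[symmetric], rule tab_mem_orbit_tabI[of 1 1 1 0]) simp_all

lemma orbit_T04_eq: "orbit T04 = orbit (tri 0 0 1 0)"
  unfolding tri_def table_as_tab
  by (rule orbit_eqI, rule tab_mem_orbit_tabI[of 0 0 1 1]) simp_all

lemma orbit_T05_eq: "orbit T05 = orbit (tri 0 0 (- 1) 2)"
  unfolding tri_def table_as_tab
  by (rule orbit_eqI, rule tab_mem_orbit_tabI[of 0 0 1 1]) simp_all

section \<open>The four lists of orbits and the triangular tables in them\<close>

definition S07 :: "'k::field mult set" where
  "S07 = orbits_T07 \<union> orbit T03 \<union> orbit T01 \<union> orbit T04 \<union> orbit (T10 1) \<union> orbit zero_alg"
definition S08 :: "'k::field mult set" where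
  "S08 = orbits_T08 \<union> orbit T03 \<union> orbit T02 \<union> orbit T05 \<union> orbit (T10 2)
            \<union> orbit (T07 (3 / 2)) \<union> orbit zero_alg"
definition S09 :: "'k::field mult set" where
  "S09 = orbit T09 \<union> orbit (T07 0) \<union> orbit (T08 1) \<union> orbit T03 \<union> orbit zero_alg"
definition S10 :: "'k::field mult set" where
  "S10 = orbits_T10 \<union> orbit T06 \<union> orbit zero_alg"

lemma orbit_nilpotent:
  "orbit (tri 0 c 0 0) = (if c = 0 then orbit zero_alg else orbit T03)"
  using orbit_tri_unit[of c 0 0 0] by (simp add: tri_def table_as_tab)

lemma orbit_tri_eq_T07:
  assumes "l \<noteq> 0" "b \<noteq> l"
  shows "orbit (tri l c b 0) = orbit (T07 (b / l))"
  using assms orbit_tri_diagonal[of b 0 l c] orbit_tri_normalize[of l 0 b 0]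
  by (simp add: table_as_tab tri_def)

lemma orbit_tri_eq_T08:
  assumes "l \<noteq> 0" "b \<noteq> 2 * l"
  shows "orbit (tri l c b (3 * l - 2 * b)) = orbit (T08 (b / l))"
proof -
  have "b + (3 * l - 2 * b) \<noteq> l"
    using assms(2) by (auto simp: algebra_simps)
  then show ?thesis
    using assms orbit_tri_diagonal[of b "3 * l - 2 * b" l c] orbit_tri_normalize[of l 0 b "3 * l - 2 * b"]
    by (simp add: table_as_tab tri_def diff_divide_distrib)
qed

lemma orbit_tri_eq_T10:
  assumes "b + g \<noteq> 0"
  shows "orbit (tri (b + g) 0 b g) = orbit (T10 (b / (b + g)))"
  using assms orbit_tri_normalize[of "b + g" 0 b g] by (simp add: orbit_T10_eq field_simps)

text \<open>The cases are: nilpotent; \<open>l = 0\<close> alone, giving \<open>T04\<close>; the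
  resonance \<open>b = l\<close>, giving \<open>T10 1\<close> or \<open>T01\<close> according to
  \<open>c\<close>; and the generic case \<open>T07 (b / l)\<close>.\<close>

lemma orbit_tri_subset_S07: "orbit (tri l c b 0) \<subseteq> S07"
proof -
  consider "l = 0" "b = 0" | "l = 0" "b \<noteq> 0" | "l \<noteq> 0" "b = l" | "l \<noteq> 0" "b \<noteq> l"
    by blast
  then show ?thesis
  proof cases
    case 1
    then show ?thesis
      using orbit_nilpotent[of c] by (auto simp: S07_def)
  next
    case 2
    then have "orbit (tri l c b 0) = orbit T04"
      using orbit_tri_diagonal[of b 0 0 c] orbit_tri_scale[of "1 / b" 1 0 0 b 0]
      by (simp add: orbit_T04_eq)
    then show ?thesis
      by (auto simp: S07_def)
  next
    case 3
    then have "orbit (tri l c b 0) = orbit (tri 1 c 1 0)"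
      using orbit_tri_normalize[of l c b 0] by simp
    moreover have "orbit (tri 1 c 1 0) = (if c = 0 then orbit (T10 1) else orbit T01)"
      using orbit_tri_unit[of c 1 1 0] by (simp add: orbit_T10_eq) (simp add: table_as_tab tri_def)
    ultimately show ?thesis
      by (auto simp: S07_def)
  next
    case 4
    define \<alpha> where "\<alpha> = b / l"
    have "orbit (tri l c b 0) = orbit (T07 \<alpha>)" "\<alpha> \<noteq> 1"
      using orbit_tri_eq_T07[OF 4] 4 by (auto simp: \<alpha>_def)
    then show ?thesis
      by (auto simp: S07_def orbits_T07_def)
  qed
qed

text \<open>With \<open>g = 3 l - 2 b\<close> the resonance is \<open>b = 2 l\<close>, giving
  \<open>T10 2\<close> or \<open>T02\<close>; \<open>l = 0\<close> gives \<open>T05\<close> or a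
  nilpotent table. The ratio \<open>b / l = 3 / 2\<close> makes \<open>g\<close> vanish and appears
  in the list as \<open>T07 (3 / 2)\<close>.\<close>

lemma orbit_tri_subset_S08:
  fixes l c b :: "'k::field_char_0"
  shows "orbit (tri l c b (3 * l - 2 * b)) \<subseteq> S08"
proof -
  consider "l = 0" "b = 0" | "l = 0" "b \<noteq> 0" | "l \<noteq> 0" "b = 2 * l" | "l \<noteq> 0" "b \<noteq> 2 * l"
    by blast
  then show ?thesis
  proof cases
    case 1
    then show ?thesis
      using orbit_nilpotent[of c] by (auto simp: S08_def)
  next
    case 2
    then have "orbit (tri l c b (3 * l - 2 * b)) = orbit T05"
      using orbit_tri_diagonal[of b "- 2 * b" 0 c] orbit_tri_scale[of "- 1 / b" 1 0 0 b "- 2 * b"]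
      by (simp add: orbit_T05_eq)
    then show ?thesis
      by (auto simp: S08_def)
  next
    case 3
    then have "orbit (tri l c b (3 * l - 2 * b)) = orbit (tri 1 c 2 (- 1))"
      using orbit_tri_normalize[of l c b "3 * l - 2 * b"] by (simp add: diff_divide_distrib)
    moreover have "orbit (tri 1 c 2 (- 1)) = (if c = 0 then orbit (T10 2) else orbit T02)"
      using orbit_tri_unit[of c 1 2 "- 1"] by (simp add: orbit_T10_eq) (simp add: table_as_tab tri_def)
    ultimately show ?thesis
      by (auto simp: S08_def)
  next
    case 4
    define \<alpha> where "\<alpha> = b / l"
    have \<alpha>: "orbit (tri l c b (3 * l - 2 * b)) = orbit (T08 \<alpha>)"
      unfolding \<alpha>_def by (rule orbit_tri_eq_T08[OF 4])
    show ?thesis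
    proof (cases "\<alpha> = 3 / 2")
      case True
      have "T08 \<alpha> = T07 (3 / 2)"
        unfolding True by (simp add: table_as_tab)
      with \<alpha> show ?thesis
        by (auto simp: S08_def)
    next
      case False
      moreover have "\<alpha> \<noteq> 2"
        using 4 by (auto simp: \<alpha>_def field_simps)
      ultimately show ?thesis
        using \<alpha> by (auto simp: S08_def orbits_T08_def)
    qed
  qed
qed

text \<open>The resonance always holds, but \<open>c = 0\<close>, so scaling suffices:
  \<open>l \<noteq> 0\<close> gives a \<open>T10\<close>, and \<open>l = 0\<close> the
  anticommutative \<open>T06\<close> or zero.\<close>

lemma orbit_tri_subset_S10: "orbit (tri (b + g) 0 b g) \<subseteq> S10"
proof -
  consider "b + g \<noteq> 0" | "b = 0" "g = 0" | "b \<noteq> 0" "g = - b"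
    by (metis add_cancel_left_right eq_neg_iff_add_eq_0 add.commute)
  then show ?thesis
  proof cases
    case 1
    then show ?thesis
      using orbit_tri_eq_T10[OF 1] by (auto simp: S10_def orbits_T10_def)
  next
    case 2
    then show ?thesis
      using orbit_nilpotent[of 0] by (auto simp: S10_def)
  next
    case 3
    then have "orbit (tri (b + g) 0 b g) = orbit T06"
      using orbit_tri_scale[of "1 / b" 1 0 0 b "- b"] by (simp add: tri_def table_as_tab)
    then show ?thesis
      by (auto simp: S10_def)
  qed
qed

text \<open>The hypothesis is associativity of the commutative triangular table.\<close>

lemma orbit_tri_subset_S09:
  fixes l c b :: "'k::field_char_0"
  assumes "b = 0 \<or> b = l"
  shows "orbit (tri l c b b) \<subseteq> S09"
proof -
  consider "l = 0" "b = 0" | "l \<noteq> 0" "b = 0" | "l \<noteq> 0" "b = l"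
    using assms by blast
  then show ?thesis
  proof cases
    case 1
    then show ?thesis
      using orbit_nilpotent[of c] by (auto simp: S09_def)
  next
    case 2
    then have "orbit (tri l c b b) = orbit (T07 0)"
      using orbit_tri_diagonal[of 0 0 l c] orbit_tri_normalize[of l 0 0 0]
      by (simp add: tri_def table_as_tab)
    then show ?thesis
      by (auto simp: S09_def)
  next
    case 3
    then have "orbit (tri l c b b) = orbit (T08 1)"
      using orbit_tri_diagonal[of l l l c] orbit_tri_normalize[of l 0 l l]
      by (simp add: tri_def table_as_tab)
    then show ?thesis
      by (auto simp: S09_def)
  qed
qed

section \<open>Closed sets containing the families\<close>

definition kernel_locus :: "(('k::field mult \<Rightarrow> 'k) \<times> ('k mult \<Rightarrow> 'k)) set \<Rightarrow> 'k mult set" where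
  "kernel_locus R = {\<mu> \<in> mults. \<exists>p q. (p \<noteq> 0 \<or> q \<noteq> 0) \<and> (\<forall>i\<in>R. fst i \<mu> * p + snd i \<mu> * q = 0)}"

lemma polynomial_functions_coord:
  "(\<lambda>\<mu>. \<mu> e1 e1 $ l) \<in> polynomial_functions" "(\<lambda>\<mu>. \<mu> e1 e2 $ l) \<in> polynomial_functions"
  "(\<lambda>\<mu>. \<mu> e2 e1 $ l) \<in> polynomial_functions" "(\<lambda>\<mu>. \<mu> e2 e2 $ l) \<in> polynomial_functions"
  unfolding e1_def e2_def by (rule polynomial_functions.coord)+

lemma polynomial_functions_uminus:
  "f \<in> polynomial_functions \<Longrightarrow> (\<lambda>\<mu>. - f \<mu>) \<in> polynomial_functions"
  using polynomial_functions.mult[OF polynomial_functions.const[of "-1"], of f] by simp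

lemmas polynomial_functions_intros = polynomial_functions_coord polynomial_functions_diff
  polynomial_functions_uminus polynomial_functions.add polynomial_functions.mult
  polynomial_functions.const

lemma closedin_kernel_locus:
  assumes "\<forall>i\<in>R. fst i \<in> polynomial_functions \<and> snd i \<in> polynomial_functions"
  shows "closedin zariski (kernel_locus R)"
  unfolding kernel_locus_def using closedin_zariski_common_kernel[of R fst snd] assms by blast

text \<open>The equations for \<open>f = (p, q)\<close>, where \<open>w = (- q, p)\<close>, \<open>L\<close> and \<open>R\<close> denote the left and right
  multiplication operators, and \<open>6 \<eta> x = 2 tr (L x) + tr (R x)\<close>. In \<open>E07\<close>: \<open>w x = 0\<close>, and \<open>f\<close> is
  proportional to \<open>x \<mapsto> tr (R x)\<close>. In \<open>E08\<close>: \<open>f (x y) = \<eta> x * f y = f x * \<eta> y\<close>. In \<open>E10\<close>: \<open>f\<close> is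
  proportional to both \<open>g\<close> and \<open>h\<close>, where \<open>x y = g x * y + h y * x\<close>; the conditions not
  involving \<open>f\<close> are written as equations for \<open>p\<close> and for \<open>q\<close>.\<close>

definition E07 :: "'k::field mult set" where
  "E07 = kernel_locus
    {(\<lambda>\<mu>. \<mu> e2 e1 $ 1, \<lambda>\<mu>. - (\<mu> e1 e1 $ 1)), (\<lambda>\<mu>. \<mu> e2 e1 $ 2, \<lambda>\<mu>. - (\<mu> e1 e1 $ 2)),
     (\<lambda>\<mu>. \<mu> e2 e2 $ 1, \<lambda>\<mu>. - (\<mu> e1 e2 $ 1)), (\<lambda>\<mu>. \<mu> e2 e2 $ 2, \<lambda>\<mu>. - (\<mu> e1 e2 $ 2)),
     (\<lambda>\<mu>. \<mu> e1 e2 $ 1 + \<mu> e2 e2 $ 2, \<lambda>\<mu>. - (\<mu> e1 e1 $ 1 + \<mu> e2 e1 $ 2))}"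

definition E08 :: "'k::field mult set" where
  "E08 = kernel_locus
    {(\<lambda>\<mu>. 3 * \<mu> e1 e1 $ 1 - 2 * \<mu> e1 e2 $ 2 - \<mu> e2 e1 $ 2, \<lambda>\<mu>. 6 * \<mu> e1 e1 $ 2),
     (\<lambda>\<mu>. 6 * \<mu> e1 e2 $ 1, \<lambda>\<mu>. 4 * \<mu> e1 e2 $ 2 - 3 * \<mu> e1 e1 $ 1 - \<mu> e2 e1 $ 2),
     (\<lambda>\<mu>. 4 * \<mu> e2 e1 $ 1 - 3 * \<mu> e2 e2 $ 2 - \<mu> e1 e2 $ 1, \<lambda>\<mu>. 6 * \<mu> e2 e1 $ 2),
     (\<lambda>\<mu>. 6 * \<mu> e2 e2 $ 1, \<lambda>\<mu>. 3 * \<mu> e2 e2 $ 2 - 2 * \<mu> e2 e1 $ 1 - \<mu> e1 e2 $ 1),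
     (\<lambda>\<mu>. 5 * \<mu> e1 e2 $ 1 - 2 * \<mu> e2 e1 $ 1 - 3 * \<mu> e2 e2 $ 2, \<lambda>\<mu>. 6 * \<mu> e1 e2 $ 2),
     (\<lambda>\<mu>. 6 * \<mu> e2 e1 $ 1, \<lambda>\<mu>. 5 * \<mu> e2 e1 $ 2 - 2 * \<mu> e1 e2 $ 2 - 3 * \<mu> e1 e1 $ 1)}"

definition E10 :: "'k::field mult set" where
  "E10 = kernel_locus
    {(\<lambda>\<mu>. \<mu> e2 e1 $ 1, \<lambda>\<mu>. - (\<mu> e1 e2 $ 2)), (\<lambda>\<mu>. \<mu> e1 e2 $ 1, \<lambda>\<mu>. - (\<mu> e2 e1 $ 2)),
     (\<lambda>\<mu>. \<mu> e1 e1 $ 2, \<lambda>\<mu>. 0), (\<lambda>\<mu>. 0, \<lambda>\<mu>. \<mu> e1 e1 $ 2),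
     (\<lambda>\<mu>. \<mu> e2 e2 $ 1, \<lambda>\<mu>. 0), (\<lambda>\<mu>. 0, \<lambda>\<mu>. \<mu> e2 e2 $ 1),
     (\<lambda>\<mu>. \<mu> e1 e1 $ 1 - \<mu> e1 e2 $ 2 - \<mu> e2 e1 $ 2, \<lambda>\<mu>. 0),
     (\<lambda>\<mu>. 0, \<lambda>\<mu>. \<mu> e1 e1 $ 1 - \<mu> e1 e2 $ 2 - \<mu> e2 e1 $ 2),
     (\<lambda>\<mu>. \<mu> e2 e2 $ 2 - \<mu> e1 e2 $ 1 - \<mu> e2 e1 $ 1, \<lambda>\<mu>. 0),
     (\<lambda>\<mu>. 0, \<lambda>\<mu>. \<mu> e2 e2 $ 2 - \<mu> e1 e2 $ 1 - \<mu> e2 e1 $ 1)}"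

lemma closedin_E07: "closedin zariski E07"
  unfolding E07_def by (rule closedin_kernel_locus) (simp add: polynomial_functions_intros)

lemma closedin_E08: "closedin zariski E08"
  unfolding E08_def by (rule closedin_kernel_locus) (simp add: polynomial_functions_intros)

lemma closedin_E10: "closedin zariski E10"
  unfolding E10_def by (rule closedin_kernel_locus) (simp add: polynomial_functions_intros)

lemma tab_E07_iff:
  "tab a1 a2 b1 b2 c1 c2 d1 d2 \<in> E07 \<longleftrightarrow> (\<exists>p q. (p \<noteq> 0 \<or> q \<noteq> 0) \<and>
     c1 * p - a1 * q = 0 \<and> c2 * p - a2 * q = 0 \<and> d1 * p - b1 * q = 0 \<and> d2 * p - b2 * q = 0 \<and>
     (b1 + d2) * p - (a1 + c2) * q = 0)"
  by (simp add: E07_def kernel_locus_def tab_nth algebra_simps)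

lemma tab_E08_iff:
  "tab a1 a2 b1 b2 c1 c2 d1 d2 \<in> E08 \<longleftrightarrow> (\<exists>p q. (p \<noteq> 0 \<or> q \<noteq> 0) \<and>
     (3 * a1 - 2 * b2 - c2) * p + 6 * a2 * q = 0 \<and> 6 * b1 * p + (4 * b2 - 3 * a1 - c2) * q = 0 \<and>
     (4 * c1 - 3 * d2 - b1) * p + 6 * c2 * q = 0 \<and> 6 * d1 * p + (3 * d2 - 2 * c1 - b1) * q = 0 \<and>
     (5 * b1 - 2 * c1 - 3 * d2) * p + 6 * b2 * q = 0 \<and> 6 * c1 * p + (5 * c2 - 2 * b2 - 3 * a1) * q = 0)"
  by (simp add: E08_def kernel_locus_def tab_nth)

lemma tab_E10_iff:
  "tab a1 a2 b1 b2 c1 c2 d1 d2 \<in> E10 \<longleftrightarrow> (\<exists>p q. (p \<noteq> 0 \<or> q \<noteq> 0) \<and>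
     c1 * p - b2 * q = 0 \<and> b1 * p - c2 * q = 0) \<and>
     a2 = 0 \<and> d1 = 0 \<and> a1 = b2 + c2 \<and> d2 = b1 + c1"
  by (auto simp: E10_def kernel_locus_def tab_nth diff_diff_eq)

text \<open>The kernel equations are symmetric under exchanging the basis vectors together with
  \<open>p\<close> and \<open>q\<close>, so the case \<open>p = 0\<close> reduces to
  \<open>p \<noteq> 0\<close>.\<close>

lemma orbit_tab_swap:
  "orbit (tab a1 a2 b1 b2 c1 c2 d1 d2) = orbit (tab d2 d1 c2 c1 b2 b1 a2 a1)"
  by (rule orbit_eqI, rule tab_mem_orbit_tabI[of 0 0 1 1]) simp_all

lemma kernel_normalize:
  fixes p q :: "'k::field"
  assumes "p \<noteq> 0" "a * p + b * q = 0"
  shows "a + b * (q / p) = 0"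
  using assms by (simp add: field_simps)

lemma E07_subset_S07: "E07 \<subseteq> (S07 :: 'k::field mult set)"
proof
  have normal: "orbit (tab a1 a2 b1 b2 c1 c2 d1 d2) \<subseteq> S07"
    if "p \<noteq> 0" "c1 * p - a1 * q = 0" "c2 * p - a2 * q = 0" "d1 * p - b1 * q = 0" "d2 * p - b2 * q = 0"
      "(b1 + d2) * p - (a1 + c2) * q = 0" for p q a1 a2 b1 b2 c1 c2 d1 d2 :: 'k
  proof -
    define t where "t = q / p"
    have "c1 = a1 * t" "c2 = a2 * t" "d1 = b1 * t" "d2 = b2 * t" "b1 + d2 = (a1 + c2) * t"
      using that by (auto simp: t_def field_simps)
    \<comment> \<open>The new basis is \<open>e1\<close>, \<open>e2 - t e1\<close>; its second
      vector spans the kernel of \<open>f\<close>, and multiplying by it from the left gives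
      zero.\<close>
    then have "tab a1 a2 b1 b2 c1 c2 d1 d2 \<in> orbit (tri (a1 + t * a2) a2 (b2 - t * a2) 0)"
      unfolding tri_def by (intro tab_mem_orbit_tabI[of 1 1 "- t" 0]) (simp_all, algebra+)
    from orbit_eqI[OF this] show ?thesis
      by (simp only: orbit_tri_subset_S07)
  qed
  fix \<mu> :: "'k mult" assume "\<mu> \<in> E07"
  then have "\<mu> \<in> mults"
    by (simp add: E07_def kernel_locus_def)
  then obtain a1 a2 b1 b2 c1 c2 d1 d2 where \<mu>: "\<mu> = tab a1 a2 b1 b2 c1 c2 d1 d2"
    using mults_eq_tab by blast
  with \<open>\<mu> \<in> E07\<close> obtain p q where pq: "p \<noteq> 0 \<or> q \<noteq> 0"
    and eqs: "c1 * p - a1 * q = 0" "c2 * p - a2 * q = 0" "d1 * p - b1 * q = 0" "d2 * p - b2 * q = 0"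
      "(b1 + d2) * p - (a1 + c2) * q = 0"
    by (auto simp: tab_E07_iff)
  have "orbit \<mu> \<subseteq> S07"
  proof (cases "p = 0")
    case False
    then show ?thesis
      unfolding \<mu> by (rule normal[OF _ eqs])
  next
    case True
    with pq have "q \<noteq> 0"
      by simp
    then show ?thesis
      unfolding \<mu> orbit_tab_swap[of a1] by (rule normal[where q = p]) (use eqs in algebra)+
  qed
  then show "\<mu> \<in> S07"
    using orbit_refl by blast
qed

lemma E08_subset_S08: "E08 \<subseteq> (S08 :: 'k::field_char_0 mult set)"
proof
  have normal: "orbit (tab a1 a2 b1 b2 c1 c2 d1 d2) \<subseteq> S08"
    if "p \<noteq> 0" "(3 * a1 - 2 * b2 - c2) * p + 6 * a2 * q = 0" "6 * b1 * p + (4 * b2 - 3 * a1 - c2) * q = 0"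
     "(4 * c1 - 3 * d2 - b1) * p + 6 * c2 * q = 0" "6 * d1 * p + (3 * d2 - 2 * c1 - b1) * q = 0"
     "(5 * b1 - 2 * c1 - 3 * d2) * p + 6 * b2 * q = 0" "6 * c1 * p + (5 * c2 - 2 * b2 - 3 * a1) * q = 0"
     for p q a1 a2 b1 b2 c1 c2 d1 d2 :: 'k
  proof -
    define t where "t = q / p"
    note eqs = that(2-)[THEN kernel_normalize[OF \<open>p \<noteq> 0\<close>], folded t_def]
    have c2: "c2 = 3 * a1 - 2 * b2 + 6 * a2 * t"
      using eqs(1) by algebra
    \<comment> \<open>The relations derived from here on say that \<open>w = e2 - t e1\<close> spans
      a two-sided ideal with \<open>w w = 0\<close>. They come out with factors 6 or 3, which can be
      cancelled in characteristic zero.\<close>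
    have "6 * (b1 + (b2 - a1 - a2 * t) * t) = 0" "6 * (c1 + (c2 - a1 - a2 * t) * t) = 0"
      using eqs(1,2,6) by algebra+
    then have "b1 + (b2 - a1 - a2 * t) * t = 0" "c1 + (c2 - a1 - a2 * t) * t = 0"
      by (metis mult_eq_0_iff zero_neq_numeral)+
    then have b1: "b1 = (a1 + a2 * t - b2) * t" and c1: "c1 = (a1 + a2 * t - c2) * t"
      by algebra+
    have "3 * (d2 - (c2 + b2) * t + a2 * t * t) = 0"
      using eqs(3) b1 c1 c2 by algebra
    then have "d2 - (c2 + b2) * t + a2 * t * t = 0"
      by (metis mult_eq_0_iff zero_neq_numeral)
    then have d2: "d2 = (c2 + b2) * t - a2 * t * t"
      by algebra
    have "6 * (d1 - (c1 + b1) * t + a1 * t * t) = 0"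
      using eqs(4) b1 c1 c2 d2 by algebra
    then have "d1 - (c1 + b1) * t + a1 * t * t = 0"
      by (metis mult_eq_0_iff zero_neq_numeral)
    then have d1: "d1 = (c1 + b1) * t - a1 * t * t"
      by algebra
    have "tab a1 a2 b1 b2 c1 c2 d1 d2 \<in>
        orbit (tri (a1 + t * a2) a2 (b2 - t * a2) (3 * (a1 + t * a2) - 2 * (b2 - t * a2)))"
      unfolding tri_def
      by (rule tab_mem_orbit_tabI[of 1 1 "- t" 0]) (simp_all add: b1 c1 c2 d1 d2 algebra_simps)
    from orbit_eqI[OF this] show ?thesis
      by (simp only: orbit_tri_subset_S08)
  qed
  fix \<mu> :: "'k mult" assume "\<mu> \<in> E08"
  then have "\<mu> \<in> mults"
    by (simp add: E08_def kernel_locus_def)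
  then obtain a1 a2 b1 b2 c1 c2 d1 d2 where \<mu>: "\<mu> = tab a1 a2 b1 b2 c1 c2 d1 d2"
    using mults_eq_tab by blast
  with \<open>\<mu> \<in> E08\<close> obtain p q where pq: "p \<noteq> 0 \<or> q \<noteq> 0"
    and eqs: "(3 * a1 - 2 * b2 - c2) * p + 6 * a2 * q = 0" "6 * b1 * p + (4 * b2 - 3 * a1 - c2) * q = 0"
     "(4 * c1 - 3 * d2 - b1) * p + 6 * c2 * q = 0" "6 * d1 * p + (3 * d2 - 2 * c1 - b1) * q = 0"
     "(5 * b1 - 2 * c1 - 3 * d2) * p + 6 * b2 * q = 0" "6 * c1 * p + (5 * c2 - 2 * b2 - 3 * a1) * q = 0"
    by (auto simp: tab_E08_iff)
  have "orbit \<mu> \<subseteq> S08"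
  proof (cases "p = 0")
    case False
    then show ?thesis
      unfolding \<mu> by (rule normal[OF _ eqs])
  next
    case True
    with pq have "q \<noteq> 0"
      by simp
    then show ?thesis
      unfolding \<mu> orbit_tab_swap[of a1] by (rule normal[where q = p]) (use eqs in algebra)+
  qed
  then show "\<mu> \<in> S08"
    using orbit_refl by blast
qed

lemma E10_subset_S10: "E10 \<subseteq> (S10 :: 'k::field mult set)"
proof
  have normal: "orbit (tab (b2 + c2) 0 b1 b2 c1 c2 0 (b1 + c1)) \<subseteq> S10"
    if "p \<noteq> 0" "c1 * p - b2 * q = 0" "b1 * p - c2 * q = 0" for p q b1 b2 c1 c2 :: 'k
  proof -
    define t where "t = q / p"
    have "c1 = b2 * t" "b1 = c2 * t"
      using that by (auto simp: t_def field_simps)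
    then have "tab (b2 + c2) 0 b1 b2 c1 c2 0 (b1 + c1) \<in> orbit (tri (b2 + c2) 0 b2 c2)"
      unfolding tri_def by (intro tab_mem_orbit_tabI[of 1 1 "- t" 0]) (simp_all add: algebra_simps)
    from orbit_eqI[OF this] show ?thesis
      by (simp only: orbit_tri_subset_S10)
  qed
  fix \<mu> :: "'k mult" assume "\<mu> \<in> E10"
  then have "\<mu> \<in> mults"
    by (simp add: E10_def kernel_locus_def)
  then obtain a1 a2 b1 b2 c1 c2 d1 d2 where \<mu>: "\<mu> = tab a1 a2 b1 b2 c1 c2 d1 d2"
    using mults_eq_tab by blast
  with \<open>\<mu> \<in> E10\<close> have \<mu>: "\<mu> = tab (b2 + c2) 0 b1 b2 c1 c2 0 (b1 + c1)"
    by (simp add: tab_E10_iff)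
  obtain p q where pq: "p \<noteq> 0 \<or> q \<noteq> 0" and eqs: "c1 * p - b2 * q = 0" "b1 * p - c2 * q = 0"
    using \<open>\<mu> \<in> E10\<close> unfolding \<mu> tab_E10_iff by blast
  have "orbit \<mu> \<subseteq> S10"
  proof (cases "p = 0")
    case False
    then show ?thesis
      unfolding \<mu> by (rule normal[OF _ eqs])
  next
    case True
    with pq have "q \<noteq> 0"
      by simp
    moreover have "orbit \<mu> = orbit (tab (c1 + b1) 0 c2 c1 b2 b1 0 (c2 + b2))"
      unfolding \<mu> orbit_tab_swap[of "b2 + c2"] by (simp add: add.commute)
    ultimately show ?thesis
      using normal[of q b2 c1 p c2 b1] eqs by (auto simp: algebra_simps)
  qed
  then show "\<mu> \<in> S10"
    using orbit_refl by blast
qed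

text \<open>With \<open>f = (p, q)\<close>, \<open>w = (- q, p)\<close> and \<open>k = (g, h)\<close>, these are the multiplications
  \<open>x y = f x * (l y + k y * w)\<close>, then \<open>x y = s f x * y + r f y * x + f x * k y * w\<close> with
  \<open>s = 2 k w - 2 r\<close>, and \<open>x y = s f x * y + r f y * x\<close>.\<close>

definition param07 :: "'k \<Rightarrow> 'k \<Rightarrow> 'k \<Rightarrow> 'k \<Rightarrow> 'k \<Rightarrow> 'k::field mult" where
  "param07 p q l g h = tab
     (p * (l - g * q)) (p * g * p) (- (p * h * q)) (p * (l + h * p))
     (q * (l - g * q)) (q * g * p) (- (q * h * q)) (q * (l + h * p))"

definition param08 :: "'k \<Rightarrow> 'k \<Rightarrow> 'k \<Rightarrow> 'k \<Rightarrow> 'k \<Rightarrow> 'k::field mult" where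
  "param08 p q r g h = (let s = 2 * (h * p - g * q) - 2 * r in tab
     ((s + r) * p - p * g * q) (p * g * p) (r * q - p * h * q) (s * p + p * h * p)
     (s * q - q * g * q) (r * p + q * g * p) (- (q * h * q)) ((s + r) * q + q * h * p))"

definition param10 :: "'k \<Rightarrow> 'k \<Rightarrow> 'k \<Rightarrow> 'k \<Rightarrow> 'k::field mult" where
  "param10 p q s r = tab ((s + r) * p) 0 (r * q) (s * p) (s * q) (r * p) 0 ((s + r) * q)"

text \<open>The form \<open>f = (p, q)\<close> of the parametrization solves the equations itself;
  if it is zero, so is the multiplication, and every nonzero form solves them.\<close>

lemma param07_mem_E07: "param07 p q l g h \<in> E07"
proof (cases "p = 0 \<and> q = 0")
  case True
  then show ?thesis
    unfolding param07_def tab_E07_iff by (intro exI[of _ 1]) simp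
next
  case False
  then show ?thesis
    unfolding param07_def tab_E07_iff
    by (intro exI[of _ p] exI[of _ q]) (auto simp: algebra_simps)
qed

lemma param08_mem_E08: "param08 p q r g h \<in> E08"
proof (cases "p = 0 \<and> q = 0")
  case True
  then show ?thesis
    unfolding param08_def Let_def tab_E08_iff by (intro exI[of _ 1]) simp
next
  case False
  then show ?thesis
    unfolding param08_def Let_def tab_E08_iff
    by (intro exI[of _ p] exI[of _ q]) (auto simp: algebra_simps)
qed

lemma param10_mem_E10: "param10 p q s r \<in> E10"
proof (cases "p = 0 \<and> q = 0")
  case True
  then show ?thesis
    unfolding param10_def tab_E10_iff by (intro conjI exI[of _ 1]) auto
next
  case False
  then show ?thesis
    unfolding param10_def tab_E10_iff
    by (intro conjI exI[of _ p] exI[of _ q]) (auto simp: algebra_simps)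
qed

section \<open>Parametrizing the generic orbits\<close>

lemma mults_eqI_basis:
  assumes "\<mu> \<in> mults" "\<nu> \<in> mults" "vdet u v \<noteq> 0" "\<mu> u u = \<nu> u u" "\<mu> u v = \<nu> u v"
    "\<mu> v u = \<nu> v u" "\<mu> v v = \<nu> v v"
  shows "\<mu> = \<nu>"
proof (intro ext)
  fix x y
  have *: "z = (vdet z v / vdet u v) *s u + (vdet u z / vdet u v) *s v" for z
    using basis_map_inverse(1)[OF assms(3), of z] by (simp add: basis_map_def)
  show "\<mu> x y = \<nu> x y"
    by (subst (1 2) *[of x], subst (1 2) *[of y]) (simp add: mults_bilinear assms)
qed

text \<open>This is the form \<open>f\<close> of the parametrizations, with \<open>f u = 1\<close>
  and \<open>f v = 0\<close>. The last two conclusions say that \<open>v\<close> is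
  \<open>vdet u v\<close> times \<open>w = (- q, p)\<close>.\<close>

lemma dual_form:
  fixes u v :: "'k::field^2"
  assumes "vdet u v \<noteq> 0"
  obtains p q where "p * u$1 + q * u$2 = 1" "p * v$1 + q * v$2 = 0"
    "vdet u v * p = v$2" "vdet u v * q = - v$1"
proof
  show "(v$2 / vdet u v) * u$1 + (- v$1 / vdet u v) * u$2 = 1"
    using assms by (simp add: field_simps) (simp add: vdet_def algebra_simps)
  show "(v$2 / vdet u v) * v$1 + (- v$1 / vdet u v) * v$2 = 0"
    by (simp add: field_simps)
  show "vdet u v * (v$2 / vdet u v) = v$2" "vdet u v * (- v$1 / vdet u v) = - v$1"
    using assms by simp_all
qed

lemma orbit_T07_subset_param07:
  assumes "\<mu> \<in> orbit (T07 \<alpha>)"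
  shows "\<exists>p q l g h. \<mu> = param07 p q l g h"
proof -
  obtain u v where \<mu>: "\<mu> \<in> mults" "vdet u v \<noteq> 0"
    "\<mu> u u = u" "\<mu> u v = \<alpha> *s v" "\<mu> v u = 0" "\<mu> v v = 0"
    using assms unfolding T07_def mem_orbit_mult_table_iff by (auto simp: basis_map_def)
  obtain p q where pq: "p * u$1 + q * u$2 = 1" "p * v$1 + q * v$2 = 0"
    "vdet u v * p = v$2" "vdet u v * q = - v$1"
    using dual_form[OF \<mu>(2)] .
  \<comment> \<open>Here \<open>k y = (\<alpha> - 1) * vdet u y\<close>, which vanishes at
    \<open>u\<close>, while \<open>k v\<close> times \<open>w\<close> is
    \<open>(\<alpha> - 1) v\<close> and corrects \<open>v\<close> to \<open>\<alpha> v\<close> in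
    the product of \<open>u\<close> and \<open>v\<close>.\<close>
  define \<nu> where "\<nu> = param07 p q 1 ((1 - \<alpha>) * u$2) ((\<alpha> - 1) * u$1)"
  have "\<nu> u u = u \<and> \<nu> u v = \<alpha> *s v \<and> \<nu> v u = 0 \<and> \<nu> v v = 0"
    unfolding \<nu>_def param07_def Let_def vec2_eq_iff tab_nth vector_smult_component zero_index
    by (intro conjI; use pq[unfolded vdet_def] in algebra)
  then have "\<mu> = \<nu>"
    by (intro mults_eqI_basis[OF \<mu>(1) _ \<mu>(2)]) (simp_all add: \<mu> \<nu>_def param07_def Let_def)
  then show ?thesis
    unfolding \<nu>_def by blast
qed

lemma orbit_T08_subset_param08:
  assumes "\<mu> \<in> orbit (T08 \<alpha>)"
  shows "\<exists>p q r g h. \<mu> = param08 p q r g h"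
proof -
  obtain u v where \<mu>: "\<mu> \<in> mults" "vdet u v \<noteq> 0"
    "\<mu> u u = u" "\<mu> u v = \<alpha> *s v" "\<mu> v u = (3 - 2 * \<alpha>) *s v" "\<mu> v v = 0"
    using assms unfolding T08_def mem_orbit_mult_table_iff by (auto simp: basis_map_def)
  obtain p q where pq: "p * u$1 + q * u$2 = 1" "p * v$1 + q * v$2 = 0"
    "vdet u v * p = v$2" "vdet u v * q = - v$1"
    using dual_form[OF \<mu>(2)] .
  \<comment> \<open>Now \<open>k y = (2 - \<alpha>) * vdet u y\<close>, hence
    \<open>k w = 2 - \<alpha>\<close> and \<open>s = 2 \<alpha> - 2\<close>. So
    \<open>u u = (s + r) u = u\<close>, \<open>u v = (s + 2 - \<alpha>) v = \<alpha> v\<close> and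
    \<open>v u = r v\<close>.\<close>
  define \<nu> where "\<nu> = param08 p q (3 - 2 * \<alpha>) ((\<alpha> - 2) * u$2) ((2 - \<alpha>) * u$1)"
  have "\<nu> u u = u \<and> \<nu> u v = \<alpha> *s v \<and> \<nu> v u = (3 - 2 * \<alpha>) *s v \<and> \<nu> v v = 0"
    unfolding \<nu>_def param08_def Let_def vec2_eq_iff tab_nth vector_smult_component zero_index
    by (intro conjI; use pq[unfolded vdet_def] in algebra)
  then have "\<mu> = \<nu>"
    by (intro mults_eqI_basis[OF \<mu>(1) _ \<mu>(2)]) (simp_all add: \<mu> \<nu>_def param08_def Let_def)
  then show ?thesis
    unfolding \<nu>_def by blast
qed

lemma orbit_T10_subset_param10:
  assumes "\<mu> \<in> orbit (T10 \<alpha>)"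
  shows "\<exists>p q s r. \<mu> = param10 p q s r"
proof -
  \<comment> \<open>The triangular form is used because both basis vectors of the listed
    \<open>T10 \<alpha>\<close> have \<open>f = 1\<close>, whereas \<open>dual_form\<close> needs
    one in the kernel.\<close>
  have "\<mu> \<in> orbit (mult_table e1 (\<alpha> *s e2) ((1 - \<alpha>) *s e2) 0)"
    using assms by (simp add: orbit_T10_eq tri_def tab_def)
  then obtain u v where \<mu>: "\<mu> \<in> mults" "vdet u v \<noteq> 0"
    "\<mu> u u = u" "\<mu> u v = \<alpha> *s v" "\<mu> v u = (1 - \<alpha>) *s v" "\<mu> v v = 0"
    unfolding mem_orbit_mult_table_iff by (auto simp: basis_map_def)
  obtain p q where pq: "p * u$1 + q * u$2 = 1" "p * v$1 + q * v$2 = 0"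
    "vdet u v * p = v$2" "vdet u v * q = - v$1"
    using dual_form[OF \<mu>(2)] .
  define \<nu> where "\<nu> = param10 p q \<alpha> (1 - \<alpha>)"
  have "\<nu> u u = u \<and> \<nu> u v = \<alpha> *s v \<and> \<nu> v u = (1 - \<alpha>) *s v \<and> \<nu> v v = 0"
    unfolding \<nu>_def param10_def Let_def vec2_eq_iff tab_nth vector_smult_component zero_index
    by (intro conjI; use pq[unfolded vdet_def] in algebra)
  then have "\<mu> = \<nu>"
    by (intro mults_eqI_basis[OF \<mu>(1) _ \<mu>(2)]) (simp_all add: \<mu> \<nu>_def param10_def Let_def)
  then show ?thesis
    unfolding \<nu>_def by blast
qed

section \<open>Degenerations along polynomial curves\<close>

lemma polynomial_curveI:
  assumes "\<And>t. c t \<in> mults"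
    and "\<And>l. polynomial_map (\<lambda>t. c t e1 e1 $ l)" "\<And>l. polynomial_map (\<lambda>t. c t e1 e2 $ l)"
    and "\<And>l. polynomial_map (\<lambda>t. c t e2 e1 $ l)" "\<And>l. polynomial_map (\<lambda>t. c t e2 e2 $ l)"
  shows "polynomial_curve c"
  unfolding polynomial_curve_def
proof (intro conjI allI)
  show "c t \<in> mults" for t
    by fact
  show "polynomial_map (\<lambda>t. c t (axis i 1) (axis j 1) $ l)" for i j l
    using assms(2-) exhaust_2[of i] exhaust_2[of j] by (auto simp: e1_def e2_def)
qed

lemma polynomial_curve_tab:
  assumes "polynomial_map a1" "polynomial_map a2" "polynomial_map b1" "polynomial_map b2"
    "polynomial_map c1" "polynomial_map c2" "polynomial_map d1" "polynomial_map d2"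
  shows "polynomial_curve (\<lambda>t. tab (a1 t) (a2 t) (b1 t) (b2 t) (c1 t) (c2 t) (d1 t) (d2 t))"
proof (rule polynomial_curveI)
  fix l :: 2
  let ?c = "\<lambda>t. tab (a1 t) (a2 t) (b1 t) (b2 t) (c1 t) (c2 t) (d1 t) (d2 t)"
  show "polynomial_map (\<lambda>t. ?c t e1 e1 $ l)" "polynomial_map (\<lambda>t. ?c t e1 e2 $ l)"
    "polynomial_map (\<lambda>t. ?c t e2 e1 $ l)" "polynomial_map (\<lambda>t. ?c t e2 e2 $ l)"
    using assms exhaust_2[of l] by (auto simp: tab_nth)
qed simp

text \<open>For fixed \<open>g\<close> the entries of \<open>act g \<mu>\<close> are linear in the
  structure constants of \<open>\<mu>\<close>.\<close>

lemma polynomial_curve_act: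
  assumes "polynomial_curve c" "g \<in> GL"
  shows "polynomial_curve (\<lambda>t. act g (c t))"
proof -
  have "polynomial_map (\<lambda>t. act g (c t) x y $ l)" for x y l
  proof -
    obtain u v where uv: "vdet u v \<noteq> 0" "g = basis_map u v"
      using GL_cases[OF assms(2)] .
    define x' y' where "x' = inv g x" and "y' = inv g y"
    have "act g (c t) x y = basis_map u v (mult_table (c t e1 e1) (c t e1 e2) (c t e2 e1) (c t e2 e2) x' y')" for t
      using mults_eq_mult_table[of "c t"] assms(1)
      by (simp add: act_def polynomial_curve_def uv(2) x'_def y'_def)
    moreover have "polynomial_map (\<lambda>t. c t e1 e1 $ l)" "polynomial_map (\<lambda>t. c t e1 e2 $ l)"
      "polynomial_map (\<lambda>t. c t e2 e1 $ l)" "polynomial_map (\<lambda>t. c t e2 e2 $ l)" for l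
      using assms(1) by (simp_all add: polynomial_curve_def e1_def e2_def)
    ultimately show ?thesis
      by (simp add: basis_map_def mult_table_def polynomial_map_intros)
  qed
  then show ?thesis
    using assms by (simp add: polynomial_curve_def act_mem_mults)
qed

text \<open>A fixed \<open>g\<close> carries the curve to one through \<open>act g (c s)\<close>
  that still lies in \<open>S\<close> outside \<open>B\<close>, so the whole orbit of the special
  point is reached.\<close>

lemma orbit_subset_closure:
  fixes c :: "'k::field_char_0 \<Rightarrow> 'k mult"
  assumes c: "polynomial_curve c" and "finite B" and "\<And>t. t \<notin> B \<Longrightarrow> orbit (c t) \<subseteq> S"
  shows "orbit (c s) \<subseteq> zariski closure_of S"
proof
  fix \<mu> assume "\<mu> \<in> orbit (c s)"
  then obtain g where g: "g \<in> GL" "\<mu> = act g (c s)"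
    by (auto simp: orbit_def)
  have "act g (c t) \<in> S" if "t \<notin> B" for t
    using assms(3)[OF that] g(1) by (auto simp: orbit_def)
  then have "finite {t. act g (c t) \<notin> S}"
    by (intro finite_subset[OF _ \<open>finite B\<close>]) auto
  then show "\<mu> \<in> zariski closure_of S"
    unfolding g(2) by (rule polynomial_curve_mem_closure[OF polynomial_curve_act[OF c g(1)]])
qed

lemma orbit_tri_subset_closure:
  fixes b :: "'k::field_char_0 \<Rightarrow> 'k"
  assumes "polynomial_map l" "polynomial_map c" "polynomial_map b" "polynomial_map g"
    and "finite B" "\<And>t. t \<notin> B \<Longrightarrow> orbit (tri (l t) (c t) (b t) (g t)) \<subseteq> S"
  shows "orbit (tri (l s) (c s) (b s) (g s)) \<subseteq> zariski closure_of S"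
  using orbit_subset_closure[of "\<lambda>t. tri (l t) (c t) (b t) (g t)" B S s] assms
  unfolding tri_def by (simp add: polynomial_curve_tab polynomial_map_const)

lemma orbit_subset_mults_table:
  "orbit T01 \<subseteq> mults" "orbit T02 \<subseteq> mults" "orbit T03 \<subseteq> mults" "orbit T04 \<subseteq> mults"
  "orbit T05 \<subseteq> mults" "orbit T06 \<subseteq> mults" "orbit (T07 \<alpha>) \<subseteq> mults" "orbit (T08 \<alpha>) \<subseteq> mults"
  "orbit T09 \<subseteq> mults" "orbit (T10 \<alpha>) \<subseteq> mults" "orbit zero_alg \<subseteq> mults"
  by (rule orbit_subset_mults, simp add: table_as_tab)+

text \<open>Each remaining orbit is that of a special point of a curve of triangular tables with
  \<open>g = 0\<close>. The finite set passed each time contains the parameters at which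
  \<open>l \<noteq> 0\<close> or \<open>b \<noteq> l\<close> fails.\<close>

lemma S07_subset_closure: "S07 \<subseteq> zariski closure_of (orbits_T07 :: 'k::field_char_0 mult set)"
proof -
  have generic: "orbit (tri l c b 0) \<subseteq> orbits_T07" if "l \<noteq> 0" "b \<noteq> l" for l c b :: 'k
  proof -
    have "b / l \<in> - {1}"
      using that by simp
    then show ?thesis
      unfolding orbit_tri_eq_T07[OF that] orbits_T07_def by blast
  qed
  have "orbits_T07 \<subseteq> zariski closure_of (orbits_T07 :: 'k mult set)"
    by (intro closure_of_subset) (auto simp: topspace_zariski orbits_T07_def dest: subsetD[OF orbit_subset_mults_table(7)])
  moreover have "orbit T03 \<subseteq> zariski closure_of (orbits_T07 :: 'k mult set)"
    using orbit_tri_subset_closure[of "\<lambda>t::'k. t" "\<lambda>_. 1" "\<lambda>_. 0" "\<lambda>_. 0" "{0}" orbits_T07 0] generic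
    by (simp add: polynomial_map_intros) (simp add: tri_def table_as_tab)
  moreover have "orbit T01 \<subseteq> zariski closure_of (orbits_T07 :: 'k mult set)"
    using orbit_tri_subset_closure[of "\<lambda>t::'k. 1" "\<lambda>_. 1" "\<lambda>t. t" "\<lambda>_. 0" "{1}" orbits_T07 1] generic
    by (simp add: polynomial_map_intros) (simp add: tri_def table_as_tab)
  moreover have "orbit T04 \<subseteq> zariski closure_of (orbits_T07 :: 'k mult set)"
    using orbit_tri_subset_closure[of "\<lambda>t::'k. t" "\<lambda>_. 0" "\<lambda>_. 1" "\<lambda>_. 0" "{0, 1}" orbits_T07 0] generic
    by (simp add: polynomial_map_intros orbit_T04_eq)
  moreover have "orbit (T10 1) \<subseteq> zariski closure_of (orbits_T07 :: 'k mult set)"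
    using orbit_tri_subset_closure[of "\<lambda>t::'k. 1" "\<lambda>_. 0" "\<lambda>t. t" "\<lambda>_. 0" "{1}" orbits_T07 1] generic
    by (simp add: polynomial_map_intros orbit_T10_eq)
  moreover have "orbit zero_alg \<subseteq> zariski closure_of (orbits_T07 :: 'k mult set)"
    using orbit_tri_subset_closure[of "\<lambda>t::'k. t" "\<lambda>_. 0" "\<lambda>_. 0" "\<lambda>_. 0" "{0}" orbits_T07 0] generic
    by (simp add: polynomial_map_intros) (simp add: tri_def table_as_tab)
  ultimately show ?thesis
    by (simp add: S07_def)
qed

lemma S08_subset_closure: "S08 \<subseteq> zariski closure_of (orbits_T08 :: 'k::field_char_0 mult set)"
proof -
  have generic: "orbit (tri l c b g) \<subseteq> orbits_T08"
    if "l \<noteq> 0" "b \<noteq> 2 * l" "2 * b \<noteq> 3 * l" "g = 3 * l - 2 * b" for l c b g :: 'k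
  proof -
    have "b / l \<in> - {2, 3 / 2}"
      using that by (auto simp: field_simps)
    then show ?thesis
      unfolding \<open>g = _\<close> orbit_tri_eq_T08[OF that(1,2)] orbits_T08_def by blast
  qed
  have "orbits_T08 \<subseteq> zariski closure_of (orbits_T08 :: 'k mult set)"
    by (intro closure_of_subset) (auto simp: topspace_zariski orbits_T08_def dest: subsetD[OF orbit_subset_mults_table(8)])
  moreover have "orbit T03 \<subseteq> zariski closure_of (orbits_T08 :: 'k mult set)"
    using orbit_tri_subset_closure[of "\<lambda>t::'k. t" "\<lambda>_. 1" "\<lambda>_. 0" "\<lambda>t. 3 * t" "{0}" orbits_T08 0] generic
    by (simp add: polynomial_map_intros) (simp add: tri_def table_as_tab)
  \<comment> \<open>Varying only \<open>b\<close> at \<open>l = 1\<close> reaches the excluded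
    ratios 2 and 3/2, hence \<open>T02\<close>, \<open>T10 2\<close> and \<open>T07 (3 / 2)\<close>
    together.\<close>
  moreover have tri: "orbit (tri 1 c b (3 - 2 * b)) \<subseteq> zariski closure_of orbits_T08" for b c :: 'k
    using orbit_tri_subset_closure[of "\<lambda>t::'k. 1" "\<lambda>_. c" "\<lambda>t. t" "\<lambda>t. 3 - 2 * t" "{2, 3 / 2}" orbits_T08 b]
      generic[of 1]
    by (auto simp add: polynomial_map_intros field_simps)
  moreover have "orbit T02 \<subseteq> zariski closure_of (orbits_T08 :: 'k mult set)"
    using tri[of 1 2] by (simp add: tri_def table_as_tab)
  moreover have "orbit (T10 2) \<subseteq> zariski closure_of (orbits_T08 :: 'k mult set)"
    using tri[of 0 2] by (simp add: orbit_T10_eq)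
  moreover have "orbit (T07 (3 / 2)) \<subseteq> zariski closure_of (orbits_T08 :: 'k mult set)"
    using tri[of 0 "3 / 2"] by (simp add: tri_def table_as_tab)
  moreover have "orbit T05 \<subseteq> zariski closure_of (orbits_T08 :: 'k mult set)"
  proof -
    \<comment> \<open>The three excluded parameters are those with \<open>l = 0\<close>,
      \<open>b = 2 l\<close> and \<open>2 b = 3 l\<close>, respectively.\<close>
    have "orbit (tri t 0 (- 1) (3 * t + 2)) \<subseteq> orbits_T08" if "t \<notin> {0, - 1 / 2, - 2 / 3}" for t :: 'k
      using that by (intro generic) (auto simp: field_simps)
    then show ?thesis
      using orbit_tri_subset_closure[of "\<lambda>t::'k. t" "\<lambda>_. 0" "\<lambda>_. - 1" "\<lambda>t. 3 * t + 2"
          "{0, - 1 / 2, - 2 / 3}" orbits_T08 0]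
      by (simp add: polynomial_map_intros orbit_T05_eq)
  qed
  moreover have "orbit zero_alg \<subseteq> zariski closure_of (orbits_T08 :: 'k mult set)"
    using orbit_tri_subset_closure[of "\<lambda>t::'k. t" "\<lambda>_. 0" "\<lambda>_. 0" "\<lambda>t. 3 * t" "{0}" orbits_T08 0] generic
    by (simp add: polynomial_map_intros) (simp add: tri_def table_as_tab)
  ultimately show ?thesis
    by (simp add: S08_def)
qed

lemma S10_subset_closure: "S10 \<subseteq> zariski closure_of (orbits_T10 :: 'k::field_char_0 mult set)"
proof -
  have generic: "orbit (tri l 0 b (l - b)) \<subseteq> orbits_T10" if "l \<noteq> 0" for l b :: 'k
    using orbit_tri_eq_T10[of b "l - b"] that by (auto simp: orbits_T10_def)
  have "orbits_T10 \<subseteq> zariski closure_of (orbits_T10 :: 'k mult set)"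
    by (intro closure_of_subset) (auto simp: topspace_zariski orbits_T10_def dest: subsetD[OF orbit_subset_mults_table(10)])
  moreover have "orbit T06 \<subseteq> zariski closure_of (orbits_T10 :: 'k mult set)"
    using orbit_tri_subset_closure[of "\<lambda>t::'k. t" "\<lambda>_. 0" "\<lambda>_. 1" "\<lambda>t. t - 1" "{0}" orbits_T10 0] generic
    by (simp add: polynomial_map_intros) (simp add: tri_def table_as_tab)
  moreover have "orbit zero_alg \<subseteq> zariski closure_of (orbits_T10 :: 'k mult set)"
    using orbit_tri_subset_closure[of "\<lambda>t::'k. t" "\<lambda>_. 0" "\<lambda>t. t" "\<lambda>_. 0" "{0}" orbits_T10 0] generic[of t t for t]
    by (simp add: polynomial_map_intros) (simp add: tri_def table_as_tab)
  ultimately show ?thesis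
    by (simp add: S10_def)
qed

lemma S09_subset_closure: "S09 \<subseteq> zariski closure_of (orbit T09 :: 'k::field_char_0 mult set)"
proof -
  have deg: "orbit (c s) \<subseteq> zariski closure_of (orbit T09)"
    if "polynomial_curve c" "\<And>t. t \<noteq> 0 \<Longrightarrow> c t \<in> orbit T09" for c and s :: 'k
  proof (rule orbit_subset_closure[OF that(1)])
    show "orbit (c t) \<subseteq> orbit T09" if "t \<notin> {0}" for t
      using orbit_eqI[OF \<open>\<And>t. t \<noteq> 0 \<Longrightarrow> c t \<in> orbit T09\<close>] that by simp
  qed simp
  have "orbit T09 \<subseteq> zariski closure_of (orbit T09 :: 'k mult set)"
    by (intro closure_of_subset) (simp add: topspace_zariski orbit_subset_mults_table)
  moreover have "orbit (T07 0) \<subseteq> zariski closure_of (orbit T09 :: 'k mult set)"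
  proof -
    have "tab 1 0 0 0 0 0 0 t \<in> orbit T09" if "t \<noteq> 0" for t :: 'k
      unfolding table_as_tab by (rule tab_mem_orbit_tabI[of 1 "1 / t" 0 0]) (use that in simp_all)
    then show ?thesis
      using deg[of "\<lambda>t. tab 1 0 0 0 0 0 0 t" 0]
      by (simp add: polynomial_curve_tab polynomial_map_intros table_as_tab)
  qed
  moreover have "orbit (T08 1) \<subseteq> zariski closure_of (orbit T09 :: 'k mult set)"
  proof -
    \<comment> \<open>Here \<open>e1\<close> is a unit and \<open>e2 e2 = t e2\<close>, so
      \<open>e1 - e2 / t\<close> and \<open>e2 / t\<close> are orthogonal idempotents.\<close>
    have "tab 1 0 0 1 0 1 0 t \<in> orbit T09" if "t \<noteq> 0" for t :: 'k
      unfolding table_as_tab by (rule tab_mem_orbit_tabI[of 1 "1 / t" 0 "- 1 / t"]) (use that in simp_all)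
    then show ?thesis
      using deg[of "\<lambda>t. tab 1 0 0 1 0 1 0 t" 0]
      by (simp add: polynomial_curve_tab polynomial_map_intros table_as_tab)
  qed
  moreover have "orbit T03 \<subseteq> zariski closure_of (orbit T09 :: 'k mult set)"
  proof -
    \<comment> \<open>With \<open>x = e1\<close> and \<open>x^2 = e2\<close> this is the algebra
      without unit generated by \<open>x\<close> subject to \<open>x^3 = t^2 x\<close>; its
      orthogonal idempotents are \<open>(x^2 + t x) / (2 t^2)\<close> and
      \<open>(x^2 - t x) / (2 t^2)\<close>.\<close>
    have "tab 0 1 (t * t) 0 (t * t) 0 0 (t * t) \<in> orbit T09" if "t \<noteq> 0" for t :: 'k
      unfolding table_as_tab
      by (rule tab_mem_orbit_tabI[of "1 / (2 * t)" "1 / (2 * t * t)" "- 1 / (2 * t)" "1 / (2 * t * t)"])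
         (use that in \<open>simp_all add: field_simps\<close>)
    then show ?thesis
      using deg[of "\<lambda>t. tab 0 1 (t * t) 0 (t * t) 0 0 (t * t)" 0]
      by (simp add: polynomial_curve_tab polynomial_map_intros table_as_tab)
  qed
  moreover have "orbit zero_alg \<subseteq> zariski closure_of (orbit T09 :: 'k mult set)"
  proof -
    have "tab t 0 0 0 0 0 0 t \<in> orbit T09" if "t \<noteq> 0" for t :: 'k
      unfolding table_as_tab by (rule tab_mem_orbit_tabI[of "1 / t" "1 / t" 0 0]) (use that in simp_all)
    then show ?thesis
      using deg[of "\<lambda>t. tab t 0 0 0 0 0 0 t" 0]
      by (simp add: polynomial_curve_tab polynomial_map_intros table_as_tab)
  qed
  ultimately show ?thesis
    by (simp add: S09_def)
qed

section \<open>Irreducibility and closures of the three parametrized families\<close>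

abbreviation lerp :: "'k::comm_ring_1 \<Rightarrow> 'k \<Rightarrow> 'k \<Rightarrow> 'k" where
  "lerp x y t \<equiv> x + t * (y - x)"

lemma irreducible_param07:
  "irreducible_in zariski {param07 p q l g h | p q l g h :: 'k::field_char_0. True}" (is "irreducible_in _ ?P")
proof (rule irreducible_in_zariskiI)
  show "?P \<noteq> {}"
    by blast
  show "?P \<subseteq> mults"
    by (auto simp: param07_def)
  fix \<mu> \<nu> assume "\<mu> \<in> ?P" "\<nu> \<in> ?P"
  then obtain p q l g h p' q' l' g' h' where \<mu>\<nu>: "\<mu> = param07 p q l g h" "\<nu> = param07 p' q' l' g' h'"
    by blast
  let ?c = "\<lambda>t. param07 (lerp p p' t) (lerp q q' t) (lerp l l' t) (lerp g g' t) (lerp h h' t)"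
  have "polynomial_curve ?c"
    unfolding param07_def by (intro polynomial_curve_tab polynomial_map_intros)
  moreover have "{t. ?c t \<notin> ?P} = {}"
    by blast
  ultimately show "\<exists>c. polynomial_curve c \<and> c 0 = \<mu> \<and> c 1 = \<nu> \<and> finite {t. c t \<notin> ?P}"
    by (intro exI[of _ ?c]) (simp add: \<mu>\<nu>)
qed

lemma irreducible_param08:
  "irreducible_in zariski {param08 p q r g h | p q r g h :: 'k::field_char_0. True}" (is "irreducible_in _ ?P")
proof (rule irreducible_in_zariskiI)
  show "?P \<noteq> {}"
    by blast
  show "?P \<subseteq> mults"
    by (auto simp: param08_def Let_def)
  fix \<mu> \<nu> assume "\<mu> \<in> ?P" "\<nu> \<in> ?P"
  then obtain p q r g h p' q' r' g' h' where \<mu>\<nu>: "\<mu> = param08 p q r g h" "\<nu> = param08 p' q' r' g' h'"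
    by blast
  let ?c = "\<lambda>t. param08 (lerp p p' t) (lerp q q' t) (lerp r r' t) (lerp g g' t) (lerp h h' t)"
  have "polynomial_curve ?c"
    unfolding param08_def Let_def by (intro polynomial_curve_tab polynomial_map_intros)
  moreover have "{t. ?c t \<notin> ?P} = {}"
    by blast
  ultimately show "\<exists>c. polynomial_curve c \<and> c 0 = \<mu> \<and> c 1 = \<nu> \<and> finite {t. c t \<notin> ?P}"
    by (intro exI[of _ ?c]) (simp add: \<mu>\<nu>)
qed

lemma irreducible_param10:
  "irreducible_in zariski {param10 p q s r | p q s r :: 'k::field_char_0. True}" (is "irreducible_in _ ?P")
proof (rule irreducible_in_zariskiI)
  show "?P \<noteq> {}"
    by blast
  show "?P \<subseteq> mults"
    by (auto simp: param10_def)
  fix \<mu> \<nu> assume "\<mu> \<in> ?P" "\<nu> \<in> ?P"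
  then obtain p q s r p' q' s' r' where \<mu>\<nu>: "\<mu> = param10 p q s r" "\<nu> = param10 p' q' s' r'"
    by blast
  let ?c = "\<lambda>t. param10 (lerp p p' t) (lerp q q' t) (lerp s s' t) (lerp r r' t)"
  have "polynomial_curve ?c"
    unfolding param10_def by (intro polynomial_curve_tab polynomial_map_intros)
  moreover have "{t. ?c t \<notin> ?P} = {}"
    by blast
  ultimately show "\<exists>c. polynomial_curve c \<and> c 0 = \<mu> \<and> c 1 = \<nu> \<and> finite {t. c t \<notin> ?P}"
    by (intro exI[of _ ?c]) (simp add: \<mu>\<nu>)
qed

text \<open>In the applications \<open>G\<close> is the union of generic orbits, \<open>P\<close> an
  irreducible set around it, \<open>E\<close> a locus of equations and \<open>S\<close> the list of
  orbits; the chain of inclusions closes up.\<close>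

lemma closure_eq_sandwich:
  assumes "G \<subseteq> P" "P \<subseteq> E" "closedin X E" "E \<subseteq> S" "S \<subseteq> X closure_of G"
  shows "X closure_of G = S" "X closure_of P = S" "E = S"
proof -
  have GP: "X closure_of G \<subseteq> X closure_of P" and PE: "X closure_of P \<subseteq> E"
    by (rule closure_of_mono[OF assms(1)], rule closure_of_minimal[OF assms(2,3)])
  show "X closure_of G = S"
    by (rule subset_antisym[OF subset_trans[OF GP subset_trans[OF PE assms(4)]] assms(5)])
  show "X closure_of P = S"
    by (rule subset_antisym[OF subset_trans[OF PE assms(4)] subset_trans[OF assms(5) GP]])
  show "E = S"
    by (rule subset_antisym[OF assms(4) subset_trans[OF subset_trans[OF assms(5) GP] PE]])
qed

lemma family07:
  shows "zariski closure_of orbits_T07 = (S07 :: 'k::field_char_0 mult set)"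
    and "irreducible_in zariski (S07 :: 'k mult set)"
    and "E07 = (S07 :: 'k mult set)"
proof -
  let ?P = "{param07 p q l g h | p q l g h :: 'k. True}"
  have sub: "orbits_T07 \<subseteq> ?P"
    unfolding orbits_T07_def by (auto dest!: orbit_T07_subset_param07)
  have "?P \<subseteq> E07"
    using param07_mem_E07 by blast
  note * = closure_eq_sandwich[OF sub this closedin_E07 E07_subset_S07 S07_subset_closure]
  show "zariski closure_of orbits_T07 = (S07 :: 'k mult set)" "E07 = (S07 :: 'k mult set)"
    by (rule *)+
  show "irreducible_in zariski (S07 :: 'k mult set)"
    \<comment> \<open>Irreducibility is known for the parametrized set and passes to its closure,
      which is the list.\<close>
    using irreducible_in_closure_of[OF irreducible_param07[where 'k = 'k]] unfolding *(2) .
qed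

lemma family08:
  shows "zariski closure_of orbits_T08 = (S08 :: 'k::field_char_0 mult set)"
    and "irreducible_in zariski (S08 :: 'k mult set)"
    and "E08 = (S08 :: 'k mult set)"
proof -
  let ?P = "{param08 p q r g h | p q r g h :: 'k. True}"
  have sub: "orbits_T08 \<subseteq> ?P"
    unfolding orbits_T08_def by (auto dest!: orbit_T08_subset_param08)
  have "?P \<subseteq> E08"
    using param08_mem_E08 by blast
  note * = closure_eq_sandwich[OF sub this closedin_E08 E08_subset_S08 S08_subset_closure]
  show "zariski closure_of orbits_T08 = (S08 :: 'k mult set)" "E08 = (S08 :: 'k mult set)"
    by (rule *)+
  show "irreducible_in zariski (S08 :: 'k mult set)"
    using irreducible_in_closure_of[OF irreducible_param08[where 'k = 'k]] unfolding *(2) .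
qed

lemma family10:
  shows "zariski closure_of orbits_T10 = (S10 :: 'k::field_char_0 mult set)"
    and "irreducible_in zariski (S10 :: 'k mult set)"
    and "E10 = (S10 :: 'k mult set)"
proof -
  let ?P = "{param10 p q s r | p q s r :: 'k. True}"
  have sub: "orbits_T10 \<subseteq> ?P"
    unfolding orbits_T10_def by (auto dest!: orbit_T10_subset_param10)
  have "?P \<subseteq> E10"
    using param10_mem_E10 by blast
  note * = closure_eq_sandwich[OF sub this closedin_E10 E10_subset_S10 S10_subset_closure]
  show "zariski closure_of orbits_T10 = (S10 :: 'k mult set)" "E10 = (S10 :: 'k mult set)"
    by (rule *)+
  show "irreducible_in zariski (S10 :: 'k mult set)"
    using irreducible_in_closure_of[OF irreducible_param10[where 'k = 'k]] unfolding *(2) .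
qed

section \<open>Commutative associative multiplications\<close>

text \<open>A multiplication in which \<open>u\<close> and \<open>v\<close> are multiples of
  orthogonal idempotents when \<open>s\<close> and the determinant are nonzero. The base change from
  \<open>T09\<close> brings in the inverse square of the determinant; the free scalar
  \<open>s\<close> in its place keeps the entries polynomial.\<close>

definition idempotent_pair :: "'k \<Rightarrow> 'k \<Rightarrow> 'k \<Rightarrow> 'k \<Rightarrow> 'k \<Rightarrow> 'k::field mult" where
  "idempotent_pair s u1 u2 v1 v2 = tab
     (s * (v2 * v2 * u1 + u2 * u2 * v1)) (s * (v2 * v2 * u2 + u2 * u2 * v2))
     (- (s * (v2 * v1 * u1 + u2 * u1 * v1))) (- (s * (v2 * v1 * u2 + u2 * u1 * v2)))
     (- (s * (v2 * v1 * u1 + u2 * u1 * v1))) (- (s * (v2 * v1 * u2 + u2 * u1 * v2)))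
     (s * (v1 * v1 * u1 + u1 * u1 * v1)) (s * (v1 * v1 * u2 + u1 * u1 * v2))"

lemma idempotent_pair_apply:
  "idempotent_pair s (u$1) (u$2) (v$1) (v$2) x y =
     (s * vdet x v * vdet y v) *s u + (s * vdet u x * vdet u y) *s v"
  by (simp add: idempotent_pair_def vec2_eq_iff tab_nth vdet_def algebra_simps)

lemma idempotent_pair_mem_orbit_T09:
  fixes s :: "'k::field"
  assumes "s \<noteq> 0" "u1 * v2 - v1 * u2 \<noteq> 0"
  shows "idempotent_pair s u1 u2 v1 v2 \<in> orbit T09"
proof -
  define u :: "'k^2" where "u = u1 *s e1 + u2 *s e2"
  define v :: "'k^2" where "v = v1 *s e1 + v2 *s e2"
  have uv: "u$1 = u1" "u$2 = u2" "v$1 = v1" "v$2 = v2"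
    by (simp_all add: u_def v_def)
  define \<mu> where "\<mu> = idempotent_pair s u1 u2 v1 v2"
  have \<mu>: "\<mu> x y = (s * vdet x v * vdet y v) *s u + (s * vdet u x * vdet u y) *s v" for x y
    unfolding \<mu>_def using idempotent_pair_apply[of s u v x y] by (simp add: uv)
  define d where "d = vdet u v"
  \<comment> \<open>Since \<open>u u = s d^2 u\<close> and \<open>v v = s d^2 v\<close>, multiplying
    both vectors by \<open>k\<close> makes them idempotent.\<close>
  define k where "k = 1 / (s * d * d)"
  have "s * d * d \<noteq> 0"
    using assms by (simp add: d_def vdet_def uv)
  then have k: "k \<noteq> 0" "k * (s * d * d) = 1"
    by (simp_all add: k_def)
  have [simp]: "vdet (k *s x) y = k * vdet x y" "vdet x (k *s y) = k * vdet x y" "vdet x x = 0" for x y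
    by (simp_all add: vdet_def algebra_simps)
  have "\<mu> \<in> orbit (tab 1 0 0 0 0 0 0 1)"
    by (rule mem_orbit_tabI[of _ "k *s u" "k *s v"])
       (use k \<open>s * d * d \<noteq> 0\<close> in \<open>simp_all add: \<mu> d_def[symmetric] mult.assoc mult.left_commute\<close>,
        simp_all add: \<mu>_def idempotent_pair_def)
  then show ?thesis
    by (simp add: table_as_tab \<mu>_def)
qed

lemma orbit_T09_eq_idempotent_pair:
  assumes "\<mu> \<in> orbit T09"
  shows "\<exists>s u1 u2 v1 v2. s \<noteq> 0 \<and> u1 * v2 - v1 * u2 \<noteq> 0 \<and> \<mu> = idempotent_pair s u1 u2 v1 v2"
proof -
  obtain u v where \<mu>: "\<mu> \<in> mults" "vdet u v \<noteq> 0" "\<mu> u u = u" "\<mu> u v = 0" "\<mu> v u = 0" "\<mu> v v = v"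
    using assms unfolding T09_def mem_orbit_mult_table_iff by (auto simp: basis_map_def)
  define s where "s = 1 / (vdet u v * vdet u v)"
  have s: "s \<noteq> 0" "s * vdet u v * vdet u v = 1"
    using \<mu>(2) by (simp_all add: s_def)
  define \<nu> where "\<nu> = idempotent_pair s (u$1) (u$2) (v$1) (v$2)"
  have "vdet u u = 0" "vdet v v = 0"
    by (simp_all add: vdet_def)
  then have "\<nu> u u = u \<and> \<nu> u v = 0 \<and> \<nu> v u = 0 \<and> \<nu> v v = v"
    by (simp add: \<nu>_def idempotent_pair_apply s(2))
  then have "\<mu> = \<nu>"
    by (intro mults_eqI_basis[OF \<mu>(1) _ \<mu>(2)]) (simp_all add: \<mu> \<nu>_def idempotent_pair_def)
  with s(1) \<mu>(2) show ?thesis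
    unfolding \<nu>_def vdet_def by blast
qed

text \<open>The parameters with nonzero \<open>s\<close> and nonzero determinant parametrize the
  orbit. A line joining two of them leaves this set only at roots of two nonzero
  polynomials.\<close>

lemma irreducible_orbit_T09: "irreducible_in zariski (orbit T09 :: 'k::field_char_0 mult set)"
proof (rule irreducible_in_zariskiI)
  show "orbit T09 \<noteq> ({} :: 'k mult set)"
    using orbit_refl by blast
  show "orbit T09 \<subseteq> (mults :: 'k mult set)"
    by (rule orbit_subset_mults_table)
  fix \<mu> \<nu> :: "'k mult" assume "\<mu> \<in> orbit T09" "\<nu> \<in> orbit T09"
  then obtain s u1 u2 v1 v2 s' u1' u2' v1' v2'
    where *: "s \<noteq> 0" "u1 * v2 - v1 * u2 \<noteq> 0" "\<mu> = idempotent_pair s u1 u2 v1 v2"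
      "\<nu> = idempotent_pair s' u1' u2' v1' v2'"
    using orbit_T09_eq_idempotent_pair by meson
  let ?c = "\<lambda>t. idempotent_pair (lerp s s' t) (lerp u1 u1' t) (lerp u2 u2' t) (lerp v1 v1' t) (lerp v2 v2' t)"
  let ?d = "\<lambda>t. lerp u1 u1' t * lerp v2 v2' t - lerp v1 v1' t * lerp u2 u2' t"
  have "polynomial_curve ?c"
    unfolding idempotent_pair_def by (intro polynomial_curve_tab polynomial_map_intros)
  have "finite {t. lerp s s' t = 0}"
    using *(1) by (intro polynomial_map_finite_roots[of "lerp s s'" 0] polynomial_map_intros) simp
  moreover have "finite {t. ?d t = 0}"
    using *(2) by (intro polynomial_map_finite_roots[of ?d 0] polynomial_map_intros) simp
  ultimately have "finite ({t. lerp s s' t = 0} \<union> {t. ?d t = 0})"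
    by (rule finite_UnI)
  moreover have "?c t \<in> orbit T09" if "lerp s s' t \<noteq> 0" "?d t \<noteq> 0" for t
    using that by (rule idempotent_pair_mem_orbit_T09)
  then have "{t. ?c t \<notin> orbit T09} \<subseteq> {t. lerp s s' t = 0} \<union> {t. ?d t = 0}"
    by blast
  ultimately have "finite {t. ?c t \<notin> orbit T09}"
    by (rule rev_finite_subset)
  with \<open>polynomial_curve ?c\<close> show "\<exists>c. polynomial_curve c \<and> c 0 = \<mu> \<and> c 1 = \<nu> \<and> finite {t. c t \<notin> orbit T09}"
    by (intro exI[of _ ?c]) (simp add: *)
qed

definition comm_assoc :: "'k mult \<Rightarrow> bool" where
  "comm_assoc \<mu> \<longleftrightarrow> (\<forall>x y. \<mu> x y = \<mu> y x) \<and> (\<forall>x y z. \<mu> (\<mu> x y) z = \<mu> x (\<mu> y z))"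

definition E09 :: "'k::field mult set" where
  "E09 = {\<mu> \<in> mults. comm_assoc \<mu>}"

text \<open>For a commutative table associativity follows from
  \<open>(e1 e1) e2 = e1 (e1 e2)\<close> and \<open>(e2 e2) e1 = e2 (e2 e1)\<close>; one of the four
  coordinate equations repeats, leaving three.\<close>

lemma tab_comm_assoc_iff:
  "comm_assoc (tab a1 a2 b1 b2 c1 c2 d1 d2) \<longleftrightarrow> c1 = b1 \<and> c2 = b2 \<and> a2 * d1 = b1 * b2 \<and>
     a1 * b2 + a2 * d2 = b1 * a2 + b2 * b2 \<and> d1 * a1 + d2 * b1 = b1 * b1 + b2 * d1" (is "?L \<longleftrightarrow> ?R")
proof
  let ?\<mu> = "tab a1 a2 b1 b2 c1 c2 d1 d2"
  assume L: ?L
  have c: "?\<mu> e1 e2 $ l = ?\<mu> e2 e1 $ l"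
    and "?\<mu> (?\<mu> e1 e1) e2 $ l = ?\<mu> e1 (?\<mu> e1 e2) $ l" "?\<mu> (?\<mu> e2 e2) e1 $ l = ?\<mu> e2 (?\<mu> e2 e1) $ l" for l
    using L unfolding comm_assoc_def by metis+
  from this[of 1] this[of 2] show ?R
    by (simp add: tab_nth)
next
  assume R: ?R
  then have c: "c1 = b1" "c2 = b2" and eqs: "a2 * d1 = b1 * b2"
      "a1 * b2 + a2 * d2 = b1 * a2 + b2 * b2" "d1 * a1 + d2 * b1 = b1 * b1 + b2 * d1"
    by auto
  let ?\<mu> = "tab a1 a2 b1 b2 c1 c2 d1 d2"
  have "?\<mu> x y = ?\<mu> y x" for x y
    by (simp add: vec2_eq_iff tab_nth c algebra_simps)
  moreover have "?\<mu> (?\<mu> x y) z = ?\<mu> x (?\<mu> y z)" for x y z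
    unfolding vec2_eq_iff tab_nth c by (intro conjI; use eqs in algebra)
  ultimately show ?L
    by (simp add: comm_assoc_def)
qed

lemma closedin_E09: "closedin zariski (E09 :: 'k::field mult set)"
proof -
  define F :: "('k mult \<Rightarrow> 'k) set" where "F =
    {\<lambda>\<mu>. \<mu> e2 e1 $ 1 - \<mu> e1 e2 $ 1, \<lambda>\<mu>. \<mu> e2 e1 $ 2 - \<mu> e1 e2 $ 2,
     \<lambda>\<mu>. \<mu> e1 e1 $ 2 * \<mu> e2 e2 $ 1 - \<mu> e1 e2 $ 1 * \<mu> e1 e2 $ 2,
     \<lambda>\<mu>. \<mu> e1 e1 $ 1 * \<mu> e1 e2 $ 2 + \<mu> e1 e1 $ 2 * \<mu> e2 e2 $ 2 - (\<mu> e1 e2 $ 1 * \<mu> e1 e1 $ 2 + \<mu> e1 e2 $ 2 * \<mu> e1 e2 $ 2),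
     \<lambda>\<mu>. \<mu> e2 e2 $ 1 * \<mu> e1 e1 $ 1 + \<mu> e2 e2 $ 2 * \<mu> e1 e2 $ 1 - (\<mu> e1 e2 $ 1 * \<mu> e1 e2 $ 1 + \<mu> e1 e2 $ 2 * \<mu> e2 e2 $ 1)}"
  have "comm_assoc \<mu> \<longleftrightarrow> (\<forall>f\<in>F. f \<mu> = 0)" if "\<mu> \<in> mults" for \<mu> :: "'k mult"
    by (subst mults_eq_tab[OF that], subst tab_comm_assoc_iff) (simp add: F_def)
  then have "(E09 :: 'k mult set) = {\<mu> \<in> mults. \<forall>f\<in>F. f \<mu> = 0}"
    by (auto simp: E09_def)
  also have "closedin zariski \<dots>"
    by (rule closedin_zariski_zeros[where f = "\<lambda>f. f"]) (auto simp: F_def intro!: polynomial_functions_intros)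
  finally show ?thesis .
qed

lemma comm_assoc_orbit:
  assumes "\<mu> \<in> orbit \<nu>" "comm_assoc \<nu>"
  shows "comm_assoc \<mu>"
proof -
  obtain g where g: "g \<in> GL" "\<mu> = act g \<nu>"
    using assms(1) by (auto simp: orbit_def)
  have inv: "inv g (g x) = x" for x
    using g(1) by (simp add: GL_def bij_is_inj)
  have comm: "\<nu> x y = \<nu> y x" and assoc: "\<nu> (\<nu> x y) z = \<nu> x (\<nu> y z)" for x y z
    using assms(2) unfolding comm_assoc_def by blast+
  have "\<mu> x y = \<mu> y x" for x y
    unfolding g(2) act_def by (subst comm) (rule refl)
  moreover have "\<mu> (\<mu> x y) z = \<mu> x (\<mu> y z)" for x y z
    by (simp add: g(2) act_def inv assoc)
  ultimately show ?thesis
    unfolding comm_assoc_def by blast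
qed

section \<open>Idempotents and elements of square zero\<close>

lemma exists_eigenvector:
  fixes \<mu> :: "'k::alg_closed_field mult"
  assumes "\<mu> \<in> mults"
  shows "\<exists>x l. x \<noteq> 0 \<and> \<mu> x x = l *s x"
proof -
  obtain a1 a2 b1 b2 c1 c2 d1 d2 where \<mu>: "\<mu> = tab a1 a2 b1 b2 c1 c2 d1 d2"
    using mults_eq_tab[OF assms] by blast
  show ?thesis
  proof (cases "d1 = 0")
    \<comment> \<open>The cubic form then vanishes at \<open>e2\<close>, the point at infinity of
      the parametrization \<open>e1 + t e2\<close> used below.\<close>
    case True
    then have "\<mu> e2 e2 = d2 *s e2"
      by (simp add: \<mu> vec2_eq_iff tab_nth)
    moreover have "e2 \<noteq> (0 :: 'k^2)"
      by (simp add: vec2_eq_iff)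
    ultimately show ?thesis
      by blast
  next
    case False
    \<comment> \<open>The value of \<open>p\<close> at \<open>t\<close> is the determinant of
      \<open>x\<close> and \<open>\<mu> x x\<close> for \<open>x = e1 + t e2\<close>; a root makes
      the two proportional.\<close>
    define p where "p = [: a2, b2 + c2 - a1, d2 - b1 - c1, - d1 :]"
    have "degree p > 0"
      using False by (simp add: p_def)
    then obtain t where "poly p t = 0"
      using alg_closed_imp_poly_has_root by blast
    then have t: "a2 + t * b2 + t * c2 + t * t * d2 = t * (a1 + t * b1 + t * c1 + t * t * d1)"
      by (simp add: p_def algebra_simps)
    define x where "x = e1 + t *s e2"
    have "\<mu> x x = (a1 + t * b1 + t * c1 + t * t * d1) *s x"
      using t by (simp add: \<mu> x_def vec2_eq_iff tab_nth algebra_simps)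
    moreover have "x \<noteq> 0"
      by (simp add: x_def vec2_eq_iff)
    ultimately show ?thesis
      by blast
  qed
qed

lemma mem_orbit_tab_idempotent_or_square_zero:
  fixes \<mu> :: "'k::alg_closed_field mult"
  assumes "\<mu> \<in> mults"
  shows "\<exists>l b1 b2 c1 c2 d1 d2. (l = 0 \<or> l = 1) \<and> \<mu> \<in> orbit (tab l 0 b1 b2 c1 c2 d1 d2)"
proof -
  obtain x l where x: "x \<noteq> 0" "\<mu> x x = l *s x"
    using exists_eigenvector[OF assms] by blast
  define k where "k = (if l = 0 then 1 else 1 / l)"
  define u where "u = k *s x"
  have "k \<noteq> 0"
    by (simp add: k_def)
  have "\<mu> u u = (k * k) *s \<mu> x x"
    using mults_bilinear[OF assms, of k x 0 0 k x 0 0] by (simp add: u_def)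
  define m :: 'k where "m = (if l = 0 then 0 else 1)"
  have uu: "\<mu> u u = m *s u"
    using x(2) \<open>\<mu> u u = _\<close> by (simp add: u_def k_def m_def vec2_eq_iff)
  have "u \<noteq> 0"
    using x(1) \<open>k \<noteq> 0\<close> by (simp add: u_def vec2_eq_iff)
  then have "vdet u e2 \<noteq> 0 \<or> vdet u e1 \<noteq> 0"
    by (auto simp: vdet_def vec2_eq_iff)
  then obtain v where v: "vdet u v \<noteq> 0"
    by blast
  have *: "z = (vdet z v / vdet u v) *s u + (vdet u z / vdet u v) *s v" for z
    using basis_map_inverse(1)[OF v, of z] by (simp add: basis_map_def)
  have "\<mu> \<in> orbit (tab m 0 (vdet (\<mu> u v) v / vdet u v) (vdet u (\<mu> u v) / vdet u v)
     (vdet (\<mu> v u) v / vdet u v) (vdet u (\<mu> v u) / vdet u v)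
     (vdet (\<mu> v v) v / vdet u v) (vdet u (\<mu> v v) / vdet u v))"
    by (rule mem_orbit_tabI[OF assms v]) (use * uu in auto)
  moreover have "m = 0 \<or> m = 1"
    by (simp add: m_def)
  ultimately show ?thesis
    by blast
qed

text \<open>This is the algebra of polynomials in \<open>X\<close> modulo
  \<open>X^2 - d2 X - d1\<close>, with \<open>e2 = X\<close>. Let \<open>r\<close> be a square root
  of a quarter of the discriminant: \<open>r = 0\<close> gives \<open>T08 1\<close>, and otherwise
  the algebra splits as \<open>T09\<close>.\<close>

lemma orbit_unital_subset_S09:
  fixes d1 d2 :: "'k::{alg_closed_field, field_char_0}"
  shows "orbit (tab 1 0 0 1 0 1 d1 d2) \<subseteq> S09"
proof -
  obtain r where r: "r\<^sup>2 = d1 + (d2 / 2)\<^sup>2"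
    using nth_root_exists[of 2 "d1 + (d2 / 2)\<^sup>2"] by auto
  define m where "m = d2 / 2"
  have "r * r = d1 + m * m"
    using r by (simp add: m_def power2_eq_square)
  then have d: "d2 = 2 * m" "d1 = r * r - m * m"
    by (simp_all add: m_def algebra_simps)
  show ?thesis
  proof (cases "r = 0")
    case True
    have "tab 1 0 0 1 0 1 d1 d2 \<in> orbit (tri 1 0 1 1)"
      unfolding tri_def by (rule tab_mem_orbit_tabI[of 1 1 "- m" 0]) (simp_all add: d True)
    from orbit_eqI[OF this] show ?thesis
      using orbit_tri_subset_S09[of 1 1 0] by simp
  next
    case False
    define k where "k = 1 / (2 * r)"
    have k: "2 * k * r = 1"
      using False by (simp add: k_def)
    have "tab 1 0 0 1 0 1 d1 d2 \<in> orbit T09"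
      unfolding table_as_tab d
    \<comment> \<open>For \<open>y = (e2 - m e1) / r\<close> one has \<open>y^2 = 1\<close>; the new
      basis consists of the orthogonal idempotents \<open>(1 + y) / 2\<close> and
      \<open>(1 - y) / 2\<close>.\<close>
    proof (rule tab_mem_orbit_tabI[of "k * r - k * m" "- k" "k * r + k * m" k])
      have "(k * r - k * m) * - k - (k * r + k * m) * k = - k"
        using k by algebra
      then show "(k * r - k * m) * - k - (k * r + k * m) * k \<noteq> 0"
        using k by auto
    qed (use k in algebra)+
    from orbit_eqI[OF this] show ?thesis
      by (auto simp: S09_def)
  qed
qed

lemma E09_subset_S09: "E09 \<subseteq> (S09 :: 'k::{alg_closed_field, field_char_0} mult set)"
proof
  fix \<mu> :: "'k mult" assume "\<mu> \<in> E09"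
  then have "\<mu> \<in> mults" "comm_assoc \<mu>"
    by (simp_all add: E09_def)
  then obtain l b1 b2 c1 c2 d1 d2 where l: "l = 0 \<or> l = 1" and
    \<mu>: "\<mu> \<in> orbit (tab l 0 b1 b2 c1 c2 d1 d2)"
    using mem_orbit_tab_idempotent_or_square_zero[of \<mu>] by blast
  have "comm_assoc (tab l 0 b1 b2 c1 c2 d1 d2)"
    using comm_assoc_orbit[OF orbit_sym[OF \<mu>] \<open>comm_assoc \<mu>\<close>] .
  then have c: "c1 = b1" "c2 = b2" and eqs: "b1 * b2 = 0" "l * b2 = b2 * b2"
    "d1 * l + d2 * b1 = b1 * b1 + b2 * d1"
    by (auto simp: tab_comm_assoc_iff)
  have "orbit (tab l 0 b1 b2 b1 b2 d1 d2) \<subseteq> S09"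
  proof -
    \<comment> \<open>If \<open>l = 0\<close>, then \<open>b2 = 0\<close> and exchanging the basis
      vectors gives a triangular table. If \<open>l = 1\<close>, the eigenvalue \<open>b2\<close> of
      multiplication by the idempotent \<open>e1\<close> is 0 or 1.\<close>
    consider "l = 0" | "l = 1" "b2 = 0" | "l = 1" "b2 = 1"
      using l eqs(2) by auto
    then show ?thesis
    proof cases
      case 1
      with eqs have "b2 = 0" "b1 = 0 \<or> b1 = d2"
        by auto
      moreover have "orbit (tab l 0 b1 b2 b1 b2 d1 d2) = orbit (tri d2 d1 b1 b1)"
        using orbit_tab_swap[of 0 0 b1 0 b1 0 d1 d2] 1 \<open>b2 = 0\<close> by (simp add: tri_def)
      ultimately show ?thesis
        by (simp add: orbit_tri_subset_S09)
    next
      case 2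
      then have d1: "d1 = b1 * b1 - d2 * b1"
        using eqs by (simp add: algebra_simps)
      \<comment> \<open>The vector \<open>e2 - b1 e1\<close> is annihilated by \<open>e1\<close>, so
        the algebra is a direct sum of two lines.\<close>
      have *: "tab l 0 b1 b2 b1 b2 d1 d2 \<in> orbit (tab 1 0 0 0 0 0 0 d2)"
        by (rule tab_mem_orbit_tabI[of 1 1 "- b1" 0]) (simp_all add: 2 d1 algebra_simps)
      show ?thesis
      proof (cases "d2 = 0")
        case True
        with orbit_eqI[OF *] show ?thesis
          by (auto simp: S09_def table_as_tab)
      next
        case False
        have "tab 1 0 0 0 0 0 0 d2 \<in> orbit T09"
          unfolding table_as_tab by (rule tab_mem_orbit_tabI[of 1 "1 / d2" 0 0]) (use False in simp_all)
        from orbit_eqI[OF this] orbit_eqI[OF *] show ?thesis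
          by (auto simp: S09_def)
      qed
    next
      case 3
      with eqs(1) show ?thesis
        using orbit_unital_subset_S09 by simp
    qed
  qed
  then show "\<mu> \<in> S09"
    using \<mu> c by auto
qed

lemma family09:
  shows "zariski closure_of (orbit T09) = (S09 :: 'k::{alg_closed_field, field_char_0} mult set)"
    and "irreducible_in zariski (S09 :: 'k mult set)"
    and "E09 = (S09 :: 'k mult set)"
proof -
  have "comm_assoc (T09 :: 'k mult)"
    by (simp add: table_as_tab tab_comm_assoc_iff)
  then have "orbit T09 \<subseteq> (E09 :: 'k mult set)"
    using orbit_subset_mults_table(9) comm_assoc_orbit by (auto simp: E09_def)
  from closure_eq_sandwich[OF this subset_refl closedin_E09 E09_subset_S09 S09_subset_closure]
  show *: "zariski closure_of (orbit T09) = (S09 :: 'k mult set)" and "E09 = (S09 :: 'k mult set)"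
    by simp_all
  show "irreducible_in zariski (S09 :: 'k mult set)"
    using irreducible_in_closure_of[OF irreducible_orbit_T09[where 'k = 'k]] unfolding * .
qed

section \<open>Terminal multiplications\<close>

definition terminal_bracket :: "'k::field mult \<Rightarrow> 'k^2 \<Rightarrow> 'k^2 \<Rightarrow> 'k^2 \<Rightarrow> 'k^2 \<Rightarrow> 'k^2" where
  "terminal_bracket \<mu> a = bracket_bil (bracket_lin (bracket_vec \<mu> a) \<mu>) \<mu>"

lemma terminal_iff: "terminal \<mu> \<longleftrightarrow> (\<forall>a x y z. terminal_bracket \<mu> a x y z = 0)"
  by (simp add: terminal_def terminal_bracket_def fun_eq_iff)

lemmas terminal_bracket_simps = terminal_bracket_def bracket_bil_def bracket_lin_def bracket_vec_def

text \<open>The brackets are built from the multiplication, addition and subtraction only, so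
  \<open>g\<close> carries the bracket of \<open>\<nu>\<close> to that of
  \<open>\<mu>\<close>.\<close>

lemma terminal_orbit:
  assumes "\<mu> \<in> orbit \<nu>" "terminal \<nu>"
  shows "terminal \<mu>"
proof -
  obtain g where g: "g \<in> GL" "\<mu> = act g \<nu>"
    using assms(1) by (auto simp: orbit_def)
  have inv: "inv g (g x) = x" "g (inv g x) = x" for x
    using g(1) by (simp_all add: GL_def bij_is_inj bij_is_surj surj_f_inv_f)
  have add: "g (x + y) = g x + g y" and scale: "g (c *s x) = c *s g x" for x y c
    using g(1) by (simp_all add: GL_def linear_vec_iff)
  have diff: "g (x - y) = g x - g y" for x y
    using add[of x "(- 1) *s y"] unfolding scale by (simp add: vec2_eq_iff)
  have \<mu>: "\<mu> (g x) (g y) = g (\<nu> x y)" for x y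
    by (simp add: g act_def inv)
  have zero: "g 0 = 0"
    using diff[of 0 0] by simp
  have "terminal_bracket \<mu> (g a) (g x) (g y) (g z) = g (terminal_bracket \<nu> a x y z)" for a x y z
    by (simp add: terminal_bracket_simps \<mu> flip: add diff)
  then have "terminal_bracket \<mu> (g a) (g x) (g y) (g z) = 0" for a x y z
    using assms(2) by (simp add: terminal_iff zero)
  from this[of "inv g _" "inv g _" "inv g _" "inv g _"] show ?thesis
    by (simp add: terminal_iff inv)
qed

lemma terminal_tri:
  assumes "g = 0 \<or> g = 3 * l - 2 * b \<or> c = 0 \<and> l = b + g"
  shows "terminal (tri l c b g)"
proof -
  have "terminal (tri l c b g)" if "g = 0 \<or> c = 0 \<and> l = b + g"
    using that
    by (auto simp: terminal_iff terminal_bracket_simps tri_def vec2_eq_iff tab_nth algebra_simps)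
  moreover have "terminal (tri l c b (3 * l - 2 * b))"
    by (simp add: terminal_iff terminal_bracket_simps tri_def vec2_eq_iff tab_nth algebra_simps)
  ultimately show ?thesis
    using assms by blast
qed

lemma terminal_T09: "terminal T09"
  by (simp add: terminal_iff terminal_bracket_simps table_as_tab vec2_eq_iff tab_nth algebra_simps)

text \<open>Just enough to reduce a coordinate of the bracket at basis vectors to a polynomial in
  the structure constants, which is left to \<open>algebra\<close>.\<close>

lemmas tab_bracket_eval = terminal_bracket_simps tab_nth vector_minus_component
  vector_add_component e1_nth e2_nth mult_zero_left mult_zero_right mult_1_left mult_1_right
  add_0_left add_0_right diff_0_right

lemma terminal_bracket_nth: "terminal \<mu> \<Longrightarrow> terminal_bracket \<mu> a x y z $ k = 0"
  by (simp add: terminal_iff)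

text \<open>The first coefficient has the factors \<open>c2\<close>, \<open>2 b2 + c2\<close> and
  \<open>b2 + c2\<close>, which lead to \<open>E07\<close>, \<open>E08\<close> and
  \<open>E10\<close>. In these branches the kernel direction \<open>w\<close> is a nonzero product
  \<open>e1 e2\<close> or \<open>e2 e1\<close>; the case \<open>b2 = c2 = 0\<close> is split
  separately.\<close>

lemma terminal_square_zero:
  fixes b1 b2 c1 c2 d1 d2 :: "'k::field_char_0"
  assumes "terminal (tab 0 0 b1 b2 c1 c2 d1 d2)"
  shows "tab 0 0 b1 b2 c1 c2 d1 d2 \<in> E07 \<union> E08 \<union> E10"
proof -
  note T = terminal_bracket_nth[OF assms]
  have "c2 * ((2 * b2 + c2) * (b2 + c2)) = 0"
    using T[of e2 e1 e1 e1 2, unfolded tab_bracket_eval] by algebra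
  then have "c2 = 0 \<or> b2 = - c2 \<or> c2 = - 2 * b2"
    by (auto simp: eq_neg_iff_add_eq_0 add.commute)
  then consider "c2 = 0" "b2 \<noteq> 0" | "c2 = 0" "b2 = 0" | "c2 \<noteq> 0" "b2 = - c2" | "b2 \<noteq> 0" "c2 = - 2 * b2"
    by (cases "b2 = 0"; cases "c2 = 0") auto
  then show ?thesis
  proof cases
    case 1
    have "b2 * b2 * c1 = 0"
      using T[of e1 e1 e2 e1 1, unfolded tab_bracket_eval] 1(1) by algebra
    then have c1: "c1 = 0"
      using 1 by simp
    have "b2 * b2 * (b1 + d2) = 0"
      using T[of e1 e1 e2 e2 2, unfolded tab_bracket_eval] 1(1) by algebra
    then have d2: "d2 = - b1"
      using 1 by (simp add: eq_neg_iff_add_eq_0 add.commute)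
    have "4 * b2 * (b1 * b1 + b2 * d1) = 0"
      using T[of e1 e1 e2 e2 1, unfolded tab_bracket_eval] 1(1) c1 d2 by algebra
    then have d1: "b1 * b1 + b2 * d1 = 0"
      using 1 by simp
    have "tab 0 0 b1 b2 c1 c2 d1 d2 \<in> E07"
      unfolding tab_E07_iff using 1 c1 d2 d1
      by (intro exI[of _ b2] exI[of _ "- b1"]) (simp add: algebra_simps)
    then show ?thesis
      by simp
  next
    case 2
    note b2_c2 = 2
    \<comment> \<open>Now \<open>e1\<close> itself spans the kernel of \<open>f = (0, 1)\<close>.
      The common factors \<open>b1\<close> and \<open>b1 + 2 c1 - 3 d2\<close> belong to
      \<open>E07\<close> and \<open>E08\<close>; if neither vanishes, both cofactors do, which is
      \<open>E10\<close>.\<close>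
    have split1: "b1 * ((b1 + 2 * c1 - 3 * d2) * (b1 + c1 - d2)) = 0"
      using T[of e1 e2 e2 e2 1, unfolded tab_bracket_eval] 2 by algebra
    have split2: "b1 * ((b1 + 2 * c1 - 3 * d2) * d1) = 0"
      using T[of e2 e2 e2 e2 1, unfolded tab_bracket_eval] 2 by algebra
    consider "b1 = 0" | "b1 + 2 * c1 - 3 * d2 = 0" | "d2 = b1 + c1" "d1 = 0"
      using split1 split2 by auto
    then show ?thesis
    proof cases
      case 1
      have "tab 0 0 b1 b2 c1 c2 d1 d2 \<in> E07"
        unfolding tab_E07_iff using 1 b2_c2 by (intro exI[of _ 0] exI[of _ 1]) simp
      then show ?thesis
        by simp
    next
      case 3
      have "tab 0 0 b1 b2 c1 c2 d1 d2 \<in> E10"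
        unfolding tab_E10_iff using 3 b2_c2 by (intro conjI exI[of _ 0] exI[of _ 1]) simp_all
      then show ?thesis
        by simp
    next
      case 2
      then have "3 * d2 - 2 * c1 - b1 = 0"
        by (simp add: algebra_simps)
      then have "tab 0 0 b1 b2 c1 c2 d1 d2 \<in> E08"
        unfolding tab_E08_iff using b2_c2 by (intro exI[of _ 0] exI[of _ 1]) simp
      then show ?thesis
        by simp
    qed
  next
    case 3
    have "c2 * c2 * (b1 + c1) = 0"
      using T[of e1 e2 e1 e1 1, unfolded tab_bracket_eval] 3(2) by algebra
    then have c1: "c1 = - b1"
      using 3 by (simp add: eq_neg_iff_add_eq_0 add.commute)
    have "2 * (c2 * c2) * d2 = 0"
      using T[of e2 e2 e1 e1 2, unfolded tab_bracket_eval] 3(2) c1 by algebra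
    then have d2: "d2 = 0"
      using 3 by simp
    have "c2 * c2 * d1 = 0"
      using T[of e2 e2 e2 e1 2, unfolded tab_bracket_eval] 3(2) by algebra
    then have "tab 0 0 b1 b2 c1 c2 d1 d2 \<in> E10"
      unfolding tab_E10_iff using 3 c1 d2
      by (intro conjI exI[of _ c2] exI[of _ b1]) (simp_all add: algebra_simps)
    then show ?thesis
      by simp
  next
    case 4
    have "2 * (b2 * b2) * (2 * b1 + c1) = 0"
      using T[of e1 e2 e1 e1 1, unfolded tab_bracket_eval] 4(2) by algebra
    then have c1: "c1 = - 2 * b1"
      using 4 by (simp add: eq_neg_iff_add_eq_0 add.commute)
    have "4 * (b2 * b2) * (b1 - d2) = 0"
      using T[of e2 e2 e1 e1 2, unfolded tab_bracket_eval] 4(2) c1 by algebra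
    then have d2: "d2 = b1"
      using 4 by simp
    have "4 * b2 * (b2 * d1 - b1 * b1) = 0"
      using T[of e2 e2 e1 e1 1, unfolded tab_bracket_eval] 4(2) c1 by algebra
    then have d1: "b2 * d1 = b1 * b1"
      using 4 by simp
    have "tab 0 0 b1 b2 c1 c2 d1 d2 \<in> E08"
      unfolding tab_E08_iff using 4 c1 d2 d1
      by (intro exI[of _ b2] exI[of _ "- b1"]) (simp add: algebra_simps)
    then show ?thesis
      by simp
  qed
qed

text \<open>If \<open>c2 = 0\<close>, the table is triangular or a direct sum of two lines.
  Otherwise \<open>e2 e2 = 0\<close>, and a further coefficient factors into the relations of the
  \<open>T08\<close> and \<open>T10\<close> families.\<close>

lemma terminal_idempotent_diagonal:
  fixes b2 c2 d1 d2 :: "'k::{alg_closed_field, field_char_0}"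
  assumes "terminal (tab 1 0 0 b2 0 c2 d1 d2)" "c2 \<noteq> 1"
  shows "orbit (tab 1 0 0 b2 0 c2 d1 d2) \<subseteq> S07 \<union> S08 \<union> S09 \<union> S10"
proof -
  note T = terminal_bracket_nth[OF assms(1)]
  show ?thesis
  proof (cases "c2 = 0")
    case True
    have d1: "d1 = 0"
      using T[of e2 e2 e1 e1 1, unfolded tab_bracket_eval] True by algebra
    have "b2 * (d2 * d2) = 0"
      using T[of e2 e1 e2 e2 2, unfolded tab_bracket_eval] True d1 by algebra
    then consider "d2 = 0" | "b2 = 0"
      by auto
    then show ?thesis
    proof cases
      case 1
      then show ?thesis
        using orbit_tri_subset_S07[of 1 0 b2] True d1 by (auto simp: tri_def)
    next
      case 2
      have "tab 1 0 0 b2 0 c2 d1 d2 \<in> E09"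
        using True d1 2 by (simp add: E09_def tab_comm_assoc_iff)
      moreover have "\<mu> \<in> E09" if "\<mu> \<in> orbit \<nu>" "\<nu> \<in> E09" for \<mu> \<nu> :: "'k mult"
        using that orbit_subset_mults comm_assoc_orbit by (auto simp: E09_def)
      ultimately show ?thesis
        using E09_subset_S09 by blast
    qed
  next
    case False
    have eq1: "c2 * d2 * (b2 - 1) = 0"
      using T[of e1 e2 e1 e2 2, unfolded tab_bracket_eval] by algebra
    have eq2: "c2 * d2 * (b2 + c2 - 2) = 0"
      using T[of e2 e1 e2 e2 2, unfolded tab_bracket_eval]
        T[of e2 e1 e1 e2 2, unfolded tab_bracket_eval] by algebra
    have "c2 * d2 * (c2 - 1) = 0"
      using eq1 eq2 by algebra
    then have d2: "d2 = 0"
      using False assms(2) by simp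
    have d1: "d1 = 0"
    proof (rule ccontr)
      \<comment> \<open>A nonzero \<open>d1\<close> forces first \<open>2 b2 + c2 = 3\<close>, then
        \<open>c2 = - 1\<close>, and a third coefficient then gives \<open>d1 = 0\<close>.\<close>
      assume "d1 \<noteq> 0"
      have "c2 * d1 * (2 * b2 + c2 - 3) = 0"
        using T[of e2 e2 e2 e1 2, unfolded tab_bracket_eval] by algebra
      then have "2 * b2 + c2 - 3 = 0"
        using False \<open>d1 \<noteq> 0\<close> by (metis mult_eq_0_iff)
      then have b2: "2 * b2 = 3 - c2"
        by algebra
      have "d1 * (1 - c2) * (1 + c2) = 0"
        using T[of e2 e2 e1 e1 1, unfolded tab_bracket_eval] b2 by algebra
      then have c2: "c2 = - 1"
        using assms(2) \<open>d1 \<noteq> 0\<close> by (auto simp: eq_neg_iff_add_eq_0 add.commute)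
      have "6 * (d1 * d1) = 0"
        using T[of e2 e2 e2 e2 1, unfolded tab_bracket_eval] b2 c2 by algebra
      with \<open>d1 \<noteq> 0\<close> show False
        by simp
    qed
    have "c2 * ((2 * b2 + c2 - 3) * (b2 + c2 - 1)) = 0"
      using T[of e2 e1 e1 e1 2, unfolded tab_bracket_eval] by algebra
    then consider "2 * b2 + c2 - 3 = 0" | "b2 + c2 - 1 = 0"
      using False by (metis mult_eq_0_iff)
    then consider "c2 = 3 * 1 - 2 * b2" | "1 = b2 + c2"
      by cases (simp_all add: algebra_simps)
    then show ?thesis
    proof cases
      case 1
      then show ?thesis
        using orbit_tri_subset_S08[of 1 0 b2] d1 d2 by (auto simp: tri_def)
    next
      case 2
      then show ?thesis
        using orbit_tri_subset_S10[of b2 c2] d1 d2 by (auto simp: tri_def)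
    qed
  qed
qed

lemma terminal_idempotent:
  fixes b1 b2 c1 c2 d1 d2 :: "'k::{alg_closed_field, field_char_0}"
  assumes "terminal (tab 1 0 b1 b2 c1 c2 d1 d2)"
  shows "orbit (tab 1 0 b1 b2 c1 c2 d1 d2) \<subseteq> S07 \<union> S08 \<union> S09 \<union> S10"
proof -
  note T = terminal_bracket_nth[OF assms]
  show ?thesis
  proof (cases "c2 = 1")
    case False
    have "(c2 - 1) * (b1 * (c2 - 1) - c1 * (b2 - 1)) = 0"
      using T[of e1 e2 e1 e1 1, unfolded tab_bracket_eval] by algebra
    then have b1: "b1 * (c2 - 1) = c1 * (b2 - 1)"
      using False by simp
    \<comment> \<open>The vector \<open>e2 + t e1\<close> is an eigenvector of right multiplication
      by \<open>e1\<close>, and the relation just found makes it one of left multiplication as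
      well.\<close>
    define t where "t = c1 / (c2 - 1)"
    have c1: "c1 = t * (c2 - 1)"
      using False by (simp add: t_def)
    then have "(c2 - 1) * (b1 - t * (b2 - 1)) = 0"
      using b1 by algebra
    then have b1: "b1 = t * (b2 - 1)"
      using False by simp
    obtain d1' d2' where *: "tab 1 0 b1 b2 c1 c2 d1 d2 \<in> orbit (tab 1 0 0 b2 0 c2 d1' d2')"
    proof
      show "tab 1 0 b1 b2 c1 c2 d1 d2 \<in> orbit (tab 1 0 0 b2 0 c2
          (t * t + t * b1 + t * c1 + d1 - (t * b2 + t * c2 + d2) * t) (t * b2 + t * c2 + d2))"
        by (rule tab_mem_orbit_tabI[of 1 1 t 0]) (simp_all add: b1 c1 algebra_simps)
    qed
    have "terminal (tab 1 0 0 b2 0 c2 d1' d2')"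
      using terminal_orbit[OF orbit_sym[OF *] assms] .
    then show ?thesis
      using terminal_idempotent_diagonal[OF _ False] orbit_eqI[OF *] by simp
  next
    \<comment> \<open>The eigenvalue 1 of right multiplication by \<open>e1\<close> is now repeated,
      so diagonalizability is not automatic. Instead \<open>b2 = 0\<close> leads to
      \<open>T10 0\<close>, and \<open>b2 = 1\<close> makes \<open>e1\<close> a unit.\<close>
    case True
    have "b2 * (2 * b2 - 2) = 0"
      using T[of e2 e1 e1 e1 2, unfolded tab_bracket_eval] True by algebra
    then consider "b2 = 0" | "b2 = 1"
      by auto
    then show ?thesis
    proof cases
      case 1
      have d2: "d2 = b1"
        using T[of e1 e2 e1 e2 2, unfolded tab_bracket_eval] True 1 by algebra
      have "2 * c1 = 0"
        using T[of e2 e2 e1 e1 2, unfolded tab_bracket_eval] True 1 d2 by algebra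
      then have c1: "c1 = 0"
        by simp
      have "2 * d1 = 0"
        using T[of e1 e1 e2 e2 1, unfolded tab_bracket_eval] True 1 d2 c1 by algebra
      then have d1: "d1 = 0"
        by simp
      have "tab 1 0 b1 b2 c1 c2 d1 d2 \<in> orbit (tri 1 0 0 1)"
        unfolding tri_def by (rule tab_mem_orbit_tabI[of 1 1 "- b1" 0]) (simp_all add: 1 True d1 d2 c1)
      from orbit_eqI[OF this] show ?thesis
        using orbit_tri_subset_S10[of 0 "1::'k"] by auto
    next
      case 2
      have "2 * b1 = 0"
        using T[of e1 e1 e2 e2 2, unfolded tab_bracket_eval] True 2 by algebra
      then have b1: "b1 = 0"
        by simp
      have c1: "c1 = 0"
        using T[of e2 e1 e2 e2 2, unfolded tab_bracket_eval]
          T[of e2 e1 e1 e2 2, unfolded tab_bracket_eval] True 2 b1 by algebra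
      show ?thesis
        using orbit_unital_subset_S09[of d1 d2] True 2 b1 c1 by auto
    qed
  qed
qed

lemma terminal_mults_subset:
  "terminal_mults \<subseteq> (S07 \<union> S08 \<union> S09 \<union> S10 :: 'k::{alg_closed_field, field_char_0} mult set)"
proof
  fix \<mu> :: "'k mult" assume "\<mu> \<in> terminal_mults"
  then have \<mu>: "\<mu> \<in> mults" "terminal \<mu>"
    by (simp_all add: terminal_mults_def)
  obtain l b1 b2 c1 c2 d1 d2 where l: "l = 0 \<or> l = 1"
    and orb: "\<mu> \<in> orbit (tab l 0 b1 b2 c1 c2 d1 d2)"
    using mem_orbit_tab_idempotent_or_square_zero[OF \<mu>(1)] by blast
  have table: "terminal (tab l 0 b1 b2 c1 c2 d1 d2)"
    using terminal_orbit[OF orbit_sym[OF orb] \<mu>(2)] .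
  from l show "\<mu> \<in> S07 \<union> S08 \<union> S09 \<union> S10"
  proof
    assume "l = 1"
    then show ?thesis
      using terminal_idempotent table orb by blast
  next
    assume "l = 0"
    then have "tab l 0 b1 b2 c1 c2 d1 d2 \<in> S07 \<union> S08 \<union> S10"
      using terminal_square_zero table family07(3) family08(3) family10(3) by blast
    then have "orbit (tab l 0 b1 b2 c1 c2 d1 d2) \<subseteq> S07 \<union> S08 \<union> S10"
      \<comment> \<open>The lists are unions of orbits, so they contain the whole orbit of each of
        their tables.\<close>
      unfolding S07_def S08_def S10_def orbits_T07_def orbits_T08_def orbits_T10_def
      using orbit_eqI by fastforce
    with orb show ?thesis
      by blast
  qed
qed

text \<open>For the converse inclusion, every listed algebra except \<open>T09\<close> has a
  triangular form satisfying one of the three relations of \<open>terminal_tri\<close>.\<close>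

lemma terminal_mults_eq:
  "terminal_mults = (S07 \<union> S08 \<union> S09 \<union> S10 :: 'k::{alg_closed_field, field_char_0} mult set)"
proof (rule subset_antisym[OF terminal_mults_subset])
  have orb: "orbit \<nu> \<subseteq> terminal_mults" if "terminal \<nu>" "\<nu> \<in> mults" for \<nu> :: "'k mult"
    using that terminal_orbit orbit_subset_mults by (auto simp: terminal_mults_def)
  have tri: "orbit (tri l c b g) \<subseteq> terminal_mults"
    if "g = 0 \<or> g = 3 * l - 2 * b \<or> c = 0 \<and> l = b + g" for l c b g :: 'k
    using terminal_tri[OF that] by (intro orb) simp_all
  have "orbit (T07 \<alpha>) \<subseteq> terminal_mults" "orbit (T08 \<alpha>) \<subseteq> terminal_mults"
    "orbit (T10 \<alpha>) \<subseteq> terminal_mults" for \<alpha> :: 'k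
    using tri[of 0 1 \<alpha> 0] tri[of "3 - 2 * \<alpha>" 1 \<alpha> 0] tri[of "1 - \<alpha>" 1 \<alpha> 0]
    by (simp_all add: orbit_T10_eq) (simp_all add: tri_def table_as_tab)
  moreover have "orbit T01 \<subseteq> (terminal_mults :: 'k mult set)" "orbit T02 \<subseteq> (terminal_mults :: 'k mult set)"
    "orbit T03 \<subseteq> (terminal_mults :: 'k mult set)" "orbit T06 \<subseteq> (terminal_mults :: 'k mult set)"
    "orbit zero_alg \<subseteq> (terminal_mults :: 'k mult set)"
    using tri[of 0 1 1 1] tri[of "- 1" 1 2 1] tri[of 0 0 0 1] tri[of "- 1" 0 1 0] tri[of 0 0 0 0]
    by (simp_all add: tri_def table_as_tab)
  moreover have "orbit T04 \<subseteq> (terminal_mults :: 'k mult set)" "orbit T05 \<subseteq> (terminal_mults :: 'k mult set)"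
    using tri[of 0 0 1 0] tri[of 2 0 "- 1" 0] by (simp_all add: orbit_T04_eq orbit_T05_eq)
  moreover have "orbit T09 \<subseteq> (terminal_mults :: 'k mult set)"
    by (rule orb[OF terminal_T09]) (simp add: table_as_tab)
  ultimately show "S07 \<union> S08 \<union> S09 \<union> S10 \<subseteq> (terminal_mults :: 'k mult set)"
    unfolding S07_def S08_def S09_def S10_def orbits_T07_def orbits_T08_def orbits_T10_def
    by (simp add: UN_subset_iff)
qed

text \<open>\<open>T04\<close>, \<open>T05\<close>, \<open>T09\<close> and \<open>T06\<close> each
  lie in just one of the four families; the exclusions are read off from the equations of the other
  three loci.\<close>

lemma T04_separates:
  fixes T :: "'k::field_char_0 mult"
  defines "T \<equiv> T04"
  shows "T \<in> S07" "T \<notin> E08" "T \<notin> E09" "T \<notin> E10"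
  unfolding T_def by (simp add: S07_def orbit_refl)
     (auto simp: table_as_tab tab_E08_iff tab_E10_iff E09_def tab_comm_assoc_iff)

lemma T05_separates:
  fixes T :: "'k::field_char_0 mult"
  defines "T \<equiv> T05"
  shows "T \<in> S08" "T \<notin> E07" "T \<notin> E09" "T \<notin> E10"
  unfolding T_def by (simp add: S08_def orbit_refl)
     (auto simp: table_as_tab tab_E07_iff tab_E10_iff E09_def tab_comm_assoc_iff)

lemma T09_separates:
  fixes T :: "'k::field_char_0 mult"
  defines "T \<equiv> T09"
  shows "T \<in> S09" "T \<notin> E07" "T \<notin> E08" "T \<notin> E10"
  unfolding T_def by (simp add: S09_def orbit_refl)
     (auto simp: table_as_tab tab_E07_iff tab_E08_iff tab_E10_iff)

lemma T06_separates:
  fixes T :: "'k::field_char_0 mult"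
  defines "T \<equiv> T06"
  shows "T \<in> S10" "T \<notin> E07" "T \<notin> E08" "T \<notin> E09"
  unfolding T_def by (simp add: S10_def orbit_refl)
     (auto simp: table_as_tab tab_E07_iff tab_E08_iff E09_def tab_comm_assoc_iff)

theorem corollary18:
  fixes C07 C08 C09 C10 :: "'k::{alg_closed_field, field_char_0} mult set"
  defines "C07 \<equiv> zariski closure_of orbits_T07"
    and "C09 \<equiv> zariski closure_of (orbit T09)"
    and "C08 \<equiv> zariski closure_of orbits_T08"
    and "C10 \<equiv> zariski closure_of orbits_T10"
  shows "irreducible_components (subtopology zariski terminal_mults) = {C07, C09, C08, C10}
    \<and> distinct [C07, C09, C08, C10]
    \<and> C07 = orbits_T07 \<union> orbit T03 \<union> orbit T01 \<union> orbit T04 \<union> orbit (T10 1) \<union> orbit zero_alg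
    \<and> C09 = orbit T09 \<union> orbit (T07 0) \<union> orbit (T08 1) \<union> orbit T03 \<union> orbit zero_alg
    \<and> C08 = orbits_T08 \<union> orbit T03 \<union> orbit T02 \<union> orbit T05 \<union> orbit (T10 2)
            \<union> orbit (T07 (3 / 2)) \<union> orbit zero_alg
    \<and> C10 = orbits_T10 \<union> orbit T06 \<union> orbit zero_alg"
proof -
  have C: "C07 = S07" "C08 = S08" "C09 = S09" "C10 = S10"
    unfolding C07_def C08_def C09_def C10_def
    by (rule family07(1) family08(1) family09(1) family10(1))+
  let ?Z = "{S07, S09, S08, S10} :: 'k mult set set"
  note separates = T04_separates[where 'k = 'k] T05_separates[where 'k = 'k]
    T09_separates[where 'k = 'k] T06_separates[where 'k = 'k]
  \<comment> \<open>The loci and the lists coincide, so these witnesses refute all twelve inclusions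
    between different lists.\<close>
  note sep = separates[unfolded family07(3) family08(3) family09(3) family10(3)]
  have nsub: "\<not> S07 \<subseteq> (S08 :: 'k mult set)" "\<not> S07 \<subseteq> (S09 :: 'k mult set)" "\<not> S07 \<subseteq> (S10 :: 'k mult set)"
    "\<not> S08 \<subseteq> (S07 :: 'k mult set)" "\<not> S08 \<subseteq> (S09 :: 'k mult set)" "\<not> S08 \<subseteq> (S10 :: 'k mult set)"
    "\<not> S09 \<subseteq> (S07 :: 'k mult set)" "\<not> S09 \<subseteq> (S08 :: 'k mult set)" "\<not> S09 \<subseteq> (S10 :: 'k mult set)"
    "\<not> S10 \<subseteq> (S07 :: 'k mult set)" "\<not> S10 \<subseteq> (S08 :: 'k mult set)" "\<not> S10 \<subseteq> (S09 :: 'k mult set)"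
    using sep by blast+
  have "irreducible_components (subtopology zariski (\<Union>?Z)) = ?Z"
  proof (rule irreducible_components_subtopology_eq)
    have "closedin zariski C07" "closedin zariski C08" "closedin zariski C09" "closedin zariski C10"
      unfolding C07_def C08_def C09_def C10_def by (rule closedin_closure_of)+
    then show "closedin zariski Z" if "Z \<in> ?Z" for Z
      using that by (auto simp: C)
    show "irreducible_in zariski Z" if "Z \<in> ?Z" for Z
      using that family07(2) family08(2) family09(2) family10(2) by auto
    show "Y = Z" if "Y \<in> ?Z" "Z \<in> ?Z" "Y \<subseteq> Z" for Y Z
      using that nsub by auto
  qed simp
  moreover have "\<Union>?Z = terminal_mults"
    unfolding terminal_mults_eq by blast
  moreover have "distinct [S07, S09, S08, S10 :: 'k mult set]"
    using nsub by auto
  ultimately show ?thesis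
    unfolding C by (simp add: S07_def S08_def S09_def S10_def)
qed

end
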